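(* Let $\Gamma$ be a regular hypertope of rank $n\ge3$ over $I=\{0,\dots,n-1\}$ with automorphism group $G$, and suppose $\Gamma$ satisfies $(B_1)$ and $(B_2)$ for the pair $\{0,1\}$. Then the coset geometry $\Gamma(H(G),(H(G)_i)_{i\in I})$ is isomorphic to the halving geometry $H(\Gamma)(0,1)$.
   Context: Incidence geometries over $I$, flags, chambers, residues, residual connectedness, thinness, truncations $\Gamma[J]$ and $0$-shadows $\sigma_0(x)$ are as usual. A regular hypertope is a thin, residually connected, flag-transitive geometry. Fix a chamber $C$; for each $i$, $\rho_i$ denotes the unique automorphism sending $C$ to its unique $i$-adjacent chamber (the chamber differing from $C$ only in its $i$-element); then $G=\langle\rho_0,\dots,\rho_{n-1}\rangle$. The halving group is $H(G)=\langle\rho_0\rho_1\rho_0,\rho_1,\dots,\rho_{n-1}\rangle$, and $H(G)_i$ is the subgroup generated by all these $n$ generators except the $i$-th one (so $H(G)_0=\langle\rho_1,\dots,\rho_{n-1}\rangle$, $H(G)_1=\langle\rho_0\rho_1\rho_0,\rho_2,\dots,\rho_{n-1}\rangle$). The coset geometry $\Gamma(K,(K_i)_{i\in I})$ has as $i$-elements the right cosets $K_ig$, two elements of distinct types being incident iff the cosets intersect. $(B_1)$: $\Gamma[0,1]$ is the geometry of a simple graph (vertices = $0$-elements, edges = $1$-elements, each edge incident to exactly two vertices, two vertices on at most one common edge); $p\sim q$ means adjacency. $(B_2)$: for a $1$-element $e$ and $x$ of type $\notin\{0,1\}$, $e*x$ iff $\sigma_0(e)\subseteq\sigma_0(x)$.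 Halving geometry $H(\Gamma)(0,1)$: if $\Gamma[0,1]$ is bipartite with colour classes $X_0,X_1$, it is $\mathcal{BP}(\Gamma)(0,1)$: elements of types $i\ge2$ are those of $\Gamma$, type-$0$ elements are the vertices in $X_0$, type-$1$ elements are the vertices in $X_1$; incidence between elements whose types are not $\{0,1\}$ is that of $\Gamma$, and a vertex of $X_0$ is incident to a vertex of $X_1$ iff they are adjacent. If $\Gamma[0,1]$ is not bipartite, it is $\mathcal{P}(\Gamma)(0,1)$: for a connected graph $\mathcal{G}$, $\pi(\mathcal{G})$ is the set of classes of the relation "joined by a walk of even length" ($\{V\}$ if non-bipartite, the two colour classes if bipartite), and $\bar P$ is the complement of $P$ if $\mathcal{G}$ is bipartite and $P$ otherwise; the elements are $(p,0)$, $(p,1)$ for $p\in S_0$, and $(x,P_x)$ with $x$ of type $i\ge2$ and $P_x\in\pi(\Gamma_x[0,1])$ (of type $i$); incidences: $(x,P_x)*'(y,P_y)$ iff $x*y$ and $P_x\cap P_y\neq\emptyset$; $(p,0)*'(y,P_y)$ iff $p*y$, $p\in P_y$; $(q,1)*'(y,P_y)$ iff $q*y$, $q\in\bar P_y$; $(p,0)*'(q,1)$ iff $p\sim q$. *)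

theory Defs
  imports "HOL-Algebra.Bij" "HOL-Algebra.Coset" "HOL-Algebra.Generated_Groups"
begin

record ('a, 'i) incidence_structure =
  elems :: "'a set"
  incident :: "'a \<Rightarrow> 'a \<Rightarrow> bool"
  ty :: "'a \<Rightarrow> 'i"
  typeset :: "'i set"

text \<open>Only finite rank is considered, so that \<^const>\<open>card\<close> of a set of types is its rank.\<close>

definition incidence_system :: "('a, 'i) incidence_structure \<Rightarrow> bool" where
  "incidence_system \<Gamma> \<longleftrightarrow>
     finite (typeset \<Gamma>) \<and>
     ty \<Gamma> ` elems \<Gamma> \<subseteq> typeset \<Gamma> \<and>
     (\<forall>x \<in> elems \<Gamma>. incident \<Gamma> x x) \<and>
     (\<forall>x \<in> elems \<Gamma>. \<forall>y \<in> elems \<Gamma>. incident \<Gamma> x y \<longrightarrow> incident \<Gamma> y x) \<and>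
     (\<forall>x \<in> elems \<Gamma>. \<forall>y \<in> elems \<Gamma>. incident \<Gamma> x y \<and> ty \<Gamma> x = ty \<Gamma> y \<longrightarrow> x = y)"

definition flag :: "('a, 'i) incidence_structure \<Rightarrow> 'a set \<Rightarrow> bool" where
  "flag \<Gamma> F \<longleftrightarrow> F \<subseteq> elems \<Gamma> \<and> (\<forall>x \<in> F. \<forall>y \<in> F. incident \<Gamma> x y)"

definition chamber :: "('a, 'i) incidence_structure \<Rightarrow> 'a set \<Rightarrow> bool" where
  "chamber \<Gamma> C \<longleftrightarrow> flag \<Gamma> C \<and> ty \<Gamma> ` C = typeset \<Gamma>"

definition incidence_geometry :: "('a, 'i) incidence_structure \<Rightarrow> bool" where
  "incidence_geometry \<Gamma> \<longleftrightarrow>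
     incidence_system \<Gamma> \<and> (\<forall>F. flag \<Gamma> F \<longrightarrow> (\<exists>C. chamber \<Gamma> C \<and> F \<subseteq> C))"

definition residue :: "('a, 'i) incidence_structure \<Rightarrow> 'a set \<Rightarrow> ('a, 'i) incidence_structure" where
  "residue \<Gamma> F = \<Gamma>\<lparr>elems := {x \<in> elems \<Gamma>. x \<notin> F \<and> (\<forall>y \<in> F. incident \<Gamma> x y)},
                   typeset := typeset \<Gamma> - ty \<Gamma> ` F\<rparr>"

definition truncation :: "('a, 'i) incidence_structure \<Rightarrow> 'i set \<Rightarrow> ('a, 'i) incidence_structure" where
  "truncation \<Gamma> J = \<Gamma>\<lparr>elems := {x \<in> elems \<Gamma>. ty \<Gamma> x \<in> J}, typeset := J\<rparr>"

definition incidence_connected :: "('a, 'i) incidence_structure \<Rightarrow> bool" where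
  "incidence_connected \<Gamma> \<longleftrightarrow>
     (\<forall>x \<in> elems \<Gamma>. \<forall>y \<in> elems \<Gamma>.
        (\<lambda>u v. u \<in> elems \<Gamma> \<and> v \<in> elems \<Gamma> \<and> incident \<Gamma> u v)\<^sup>*\<^sup>* x y)"

definition residually_connected :: "('a, 'i) incidence_structure \<Rightarrow> bool" where
  "residually_connected \<Gamma> \<longleftrightarrow>
     (\<forall>F. flag \<Gamma> F \<and> card (typeset (residue \<Gamma> F)) \<ge> 2 \<longrightarrow> incidence_connected (residue \<Gamma> F))"

definition thin :: "('a, 'i) incidence_structure \<Rightarrow> bool" where
  "thin \<Gamma> \<longleftrightarrow>
     (\<forall>F. flag \<Gamma> F \<and> card (typeset (residue \<Gamma> F)) = 1 \<longrightarrow> card (elems (residue \<Gamma> F)) = 2)"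

definition automorphisms :: "('a, 'i) incidence_structure \<Rightarrow> ('a \<Rightarrow> 'a) set" where
  "automorphisms \<Gamma> =
     {f \<in> Bij (elems \<Gamma>).
        (\<forall>x \<in> elems \<Gamma>. ty \<Gamma> (f x) = ty \<Gamma> x) \<and>
        (\<forall>x \<in> elems \<Gamma>. \<forall>y \<in> elems \<Gamma>. incident \<Gamma> (f x) (f y) \<longleftrightarrow> incident \<Gamma> x y)}"

definition Aut :: "('a, 'i) incidence_structure \<Rightarrow> ('a \<Rightarrow> 'a) monoid" where
  "Aut \<Gamma> = (BijGroup (elems \<Gamma>))\<lparr>carrier := automorphisms \<Gamma>\<rparr>"

definition flag_transitive :: "('a, 'i) incidence_structure \<Rightarrow> bool" where
  "flag_transitive \<Gamma> \<longleftrightarrow>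
     (\<forall>F F'. flag \<Gamma> F \<and> flag \<Gamma> F' \<and> ty \<Gamma> ` F = ty \<Gamma> ` F' \<longrightarrow>
        (\<exists>g \<in> carrier (Aut \<Gamma>). g ` F = F'))"

definition regular_hypertope :: "('a, 'i) incidence_structure \<Rightarrow> bool" where
  "regular_hypertope \<Gamma> \<longleftrightarrow>
     incidence_geometry \<Gamma> \<and> thin \<Gamma> \<and> residually_connected \<Gamma> \<and> flag_transitive \<Gamma>"

definition isomorphic :: "('a, 'i) incidence_structure \<Rightarrow> ('b, 'i) incidence_structure \<Rightarrow> bool" where
  "isomorphic \<Gamma> \<Delta> \<longleftrightarrow>
     typeset \<Gamma> = typeset \<Delta> \<and>
     (\<exists>f. bij_betw f (elems \<Gamma>) (elems \<Delta>) \<and>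
        (\<forall>x \<in> elems \<Gamma>. ty \<Delta> (f x) = ty \<Gamma> x) \<and>
        (\<forall>x \<in> elems \<Gamma>. \<forall>y \<in> elems \<Gamma>. incident \<Delta> (f x) (f y) \<longleftrightarrow> incident \<Gamma> x y))"

definition i_adjacent :: "('a, 'i) incidence_structure \<Rightarrow> 'i \<Rightarrow> 'a set \<Rightarrow> 'a set \<Rightarrow> bool" where
  "i_adjacent \<Gamma> i C D \<longleftrightarrow>
     chamber \<Gamma> C \<and> chamber \<Gamma> D \<and> C \<noteq> D \<and> {x \<in> C. ty \<Gamma> x \<noteq> i} = {x \<in> D. ty \<Gamma> x \<noteq> i}"

definition rho :: "('a, 'i) incidence_structure \<Rightarrow> 'a set \<Rightarrow> 'i \<Rightarrow> 'a \<Rightarrow> 'a" where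
  "rho \<Gamma> C i = (THE g. g \<in> carrier (Aut \<Gamma>) \<and> i_adjacent \<Gamma> i C (g ` C))"

definition halving_gen :: "('a, nat) incidence_structure \<Rightarrow> 'a set \<Rightarrow> nat \<Rightarrow> 'a \<Rightarrow> 'a" where
  "halving_gen \<Gamma> C i =
     (if i = 0 then rho \<Gamma> C 0 \<otimes>\<^bsub>Aut \<Gamma>\<^esub> rho \<Gamma> C 1 \<otimes>\<^bsub>Aut \<Gamma>\<^esub> rho \<Gamma> C 0 else rho \<Gamma> C i)"

definition halving_group :: "('a, nat) incidence_structure \<Rightarrow> 'a set \<Rightarrow> ('a \<Rightarrow> 'a) monoid" where
  "halving_group \<Gamma> C = (Aut \<Gamma>)\<lparr>carrier := generate (Aut \<Gamma>) (halving_gen \<Gamma> C ` typeset \<Gamma>)\<rparr>"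

definition halving_subgroup :: "('a, nat) incidence_structure \<Rightarrow> 'a set \<Rightarrow> nat \<Rightarrow> ('a \<Rightarrow> 'a) set" where
  "halving_subgroup \<Gamma> C i = generate (Aut \<Gamma>) (halving_gen \<Gamma> C ` (typeset \<Gamma> - {i}))"

text \<open>Cosets are tagged with their type because the members of the family need not be distinct.\<close>

definition coset_geometry ::
  "('g, 'b) monoid_scheme \<Rightarrow> 'i set \<Rightarrow> ('i \<Rightarrow> 'g set) \<Rightarrow> ('i \<times> 'g set, 'i) incidence_structure" where
  "coset_geometry K I Ks =
     \<lparr>elems = {(i, Ks i #>\<^bsub>K\<^esub> g) | i g. i \<in> I \<and> g \<in> carrier K},
      incident = (\<lambda>(i, A) (j, B). if i = j then A = B else A \<inter> B \<noteq> {}),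
      ty = fst,
      typeset = I\<rparr>"

definition shadow0 :: "('a, nat) incidence_structure \<Rightarrow> 'a \<Rightarrow> 'a set" where
  "shadow0 \<Gamma> x = {p \<in> elems \<Gamma>. ty \<Gamma> p = 0 \<and> incident \<Gamma> p x}"

text \<open>A structure over the types 0 and 1 read as a graph: vertices are its 0-elements, edges its
  1-elements.\<close>

definition vertices :: "('a, nat) incidence_structure \<Rightarrow> 'a set" where
  "vertices \<Delta> = {p \<in> elems \<Delta>. ty \<Delta> p = 0}"

definition edges :: "('a, nat) incidence_structure \<Rightarrow> 'a set" where
  "edges \<Delta> = {e \<in> elems \<Delta>. ty \<Delta> e = 1}"

definition simple_graph_geometry :: "('a, nat) incidence_structure \<Rightarrow> bool" where
  "simple_graph_geometry \<Delta> \<longleftrightarrow>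
     (\<forall>e \<in> edges \<Delta>. card {p \<in> vertices \<Delta>. incident \<Delta> p e} = 2) \<and>
     (\<forall>p \<in> vertices \<Delta>. \<forall>q \<in> vertices \<Delta>. \<forall>e \<in> edges \<Delta>. \<forall>f \<in> edges \<Delta>.
        p \<noteq> q \<and> incident \<Delta> p e \<and> incident \<Delta> q e \<and> incident \<Delta> p f \<and> incident \<Delta> q f \<longrightarrow> e = f)"

definition adj :: "('a, nat) incidence_structure \<Rightarrow> 'a \<Rightarrow> 'a \<Rightarrow> bool" where
  "adj \<Delta> p q \<longleftrightarrow>
     p \<in> vertices \<Delta> \<and> q \<in> vertices \<Delta> \<and> p \<noteq> q \<and>
     (\<exists>e \<in> edges \<Delta>. incident \<Delta> p e \<and> incident \<Delta> q e)"

definition bipartition :: "('a, nat) incidence_structure \<Rightarrow> 'a set \<Rightarrow> 'a set \<Rightarrow> bool" where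
  "bipartition \<Delta> X0 X1 \<longleftrightarrow>
     X0 \<union> X1 = vertices \<Delta> \<and> X0 \<inter> X1 = {} \<and>
     (\<forall>p q. adj \<Delta> p q \<longrightarrow> (p \<in> X0 \<longleftrightarrow> q \<in> X1))"

definition bipartite :: "('a, nat) incidence_structure \<Rightarrow> bool" where
  "bipartite \<Delta> \<longleftrightarrow> (\<exists>X0 X1. bipartition \<Delta> X0 X1)"

definition even_walk :: "('a, nat) incidence_structure \<Rightarrow> 'a \<Rightarrow> 'a \<Rightarrow> bool" where
  "even_walk \<Delta> p q \<longleftrightarrow> (\<exists>k. even k \<and> (adj \<Delta> ^^ k) p q)"

definition parts :: "('a, nat) incidence_structure \<Rightarrow> 'a set set" where
  "parts \<Delta> = {{q \<in> vertices \<Delta>. even_walk \<Delta> p q} | p. p \<in> vertices \<Delta>}"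

definition opposite_part :: "('a, nat) incidence_structure \<Rightarrow> 'a set \<Rightarrow> 'a set" where
  "opposite_part \<Delta> P = (if bipartite \<Delta> then vertices \<Delta> - P else P)"

definition B1 :: "('a, nat) incidence_structure \<Rightarrow> bool" where
  "B1 \<Gamma> \<longleftrightarrow> simple_graph_geometry (truncation \<Gamma> {0, 1})"

definition B2 :: "('a, nat) incidence_structure \<Rightarrow> bool" where
  "B2 \<Gamma> \<longleftrightarrow>
     (\<forall>e \<in> elems \<Gamma>. \<forall>x \<in> elems \<Gamma>. ty \<Gamma> e = 1 \<and> ty \<Gamma> x \<notin> {0, 1} \<longrightarrow>
        (incident \<Gamma> e x \<longleftrightarrow> shadow0 \<Gamma> e \<subseteq> shadow0 \<Gamma> x))"

definition BP_geometry ::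
  "('a, nat) incidence_structure \<Rightarrow> 'a set \<Rightarrow> 'a set \<Rightarrow> ('a, nat) incidence_structure" where
  "BP_geometry \<Gamma> X0 X1 =
     \<lparr>elems = X0 \<union> X1 \<union> {x \<in> elems \<Gamma>. ty \<Gamma> x \<ge> 2},
      incident = (\<lambda>x y.
        if x \<in> X0 \<and> y \<in> X1 \<or> x \<in> X1 \<and> y \<in> X0 then adj (truncation \<Gamma> {0, 1}) x y
        else incident \<Gamma> x y),
      ty = (\<lambda>x. if x \<in> X0 then 0 else if x \<in> X1 then 1 else ty \<Gamma> x),
      typeset = typeset \<Gamma>\<rparr>"

datatype 'a P_elem = Vert0 'a | Vert1 'a | Part 'a "'a set"

abbreviation residue_graph :: "('a, nat) incidence_structure \<Rightarrow> 'a \<Rightarrow> ('a, nat) incidence_structure" where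
  "residue_graph \<Gamma> x \<equiv> truncation (residue \<Gamma> {x}) {0, 1}"

fun P_ty :: "('a, nat) incidence_structure \<Rightarrow> 'a P_elem \<Rightarrow> nat" where
  "P_ty \<Gamma> (Vert0 p) = 0"
| "P_ty \<Gamma> (Vert1 p) = 1"
| "P_ty \<Gamma> (Part x P) = ty \<Gamma> x"

fun P_incident :: "('a, nat) incidence_structure \<Rightarrow> 'a P_elem \<Rightarrow> 'a P_elem \<Rightarrow> bool" where
  "P_incident \<Gamma> (Vert0 p) (Vert0 q) \<longleftrightarrow> p = q"
| "P_incident \<Gamma> (Vert1 p) (Vert1 q) \<longleftrightarrow> p = q"
| "P_incident \<Gamma> (Vert0 p) (Vert1 q) \<longleftrightarrow> adj (truncation \<Gamma> {0, 1}) p q"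
| "P_incident \<Gamma> (Vert1 q) (Vert0 p) \<longleftrightarrow> adj (truncation \<Gamma> {0, 1}) p q"
| "P_incident \<Gamma> (Vert0 p) (Part y P) \<longleftrightarrow> incident \<Gamma> p y \<and> p \<in> P"
| "P_incident \<Gamma> (Part y P) (Vert0 p) \<longleftrightarrow> incident \<Gamma> p y \<and> p \<in> P"
| "P_incident \<Gamma> (Vert1 q) (Part y P) \<longleftrightarrow>
     incident \<Gamma> q y \<and> q \<in> opposite_part (residue_graph \<Gamma> y) P"
| "P_incident \<Gamma> (Part y P) (Vert1 q) \<longleftrightarrow>
     incident \<Gamma> q y \<and> q \<in> opposite_part (residue_graph \<Gamma> y) P"
| "P_incident \<Gamma> (Part x P) (Part y Q) \<longleftrightarrow> incident \<Gamma> x y \<and> P \<inter> Q \<noteq> {}"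

definition P_geometry :: "('a, nat) incidence_structure \<Rightarrow> ('a P_elem, nat) incidence_structure" where
  "P_geometry \<Gamma> =
     \<lparr>elems = Vert0 ` {p \<in> elems \<Gamma>. ty \<Gamma> p = 0} \<union> Vert1 ` {p \<in> elems \<Gamma>. ty \<Gamma> p = 0} \<union>
        {Part x P | x P. x \<in> elems \<Gamma> \<and> ty \<Gamma> x \<ge> 2 \<and> P \<in> parts (residue_graph \<Gamma> x)},
      incident = P_incident \<Gamma>,
      ty = P_ty \<Gamma>,
      typeset = typeset \<Gamma>\<rparr>"

end

theory Submission
  imports Defs
begin

text \<open>Write \<open>p\<close> and \<open>q = \<rho>\<^sub>0 p\<close> for the ends of the edge in the base chamber. By \<open>(B\<^sub>1)\<close> and \<open>(B\<^sub>2)\<close>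
  every \<open>\<rho>\<^sub>i\<close> with \<open>i \<ge> 2\<close> fixes \<open>q\<close>, hence commutes with \<open>\<rho>\<^sub>0\<close>, and conjugation by \<open>\<rho>\<^sub>0\<close> preserves
  the subgroup \<open>H\<^sub>K\<close> generated by the halving generators with index outside \<open>K\<close>, for every set \<open>K\<close> of
  types \<open>\<ge> 2\<close>. The key point is that, in the graph of the residue of the base flag of type \<open>K\<close>, the
  vertices reached from \<open>p\<close> by walks of even length are exactly those of the orbit \<open>H\<^sub>K p\<close>, and the ones
  reached by walks of odd length those of \<open>H\<^sub>K q\<close>. Since \<open>H\<^sub>K\<close> contains the stabilizer of \<open>p\<close> and of the
  base flag of type \<open>K\<close>, this identifies \<open>H(G)\<close> and its subgroups \<open>H(G)\<^sub>i\<close> with stabilizers of colour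
  classes and of base elements of the halving geometry, on whose incident pairs \<open>H(G)\<close> is transitive.\<close>

section \<open>Isomorphisms and coset geometries\<close>

text \<open>The difficulty is that subgroups given by generators must be recognized as stabilizers.
  The halving generators of index >= 1 fix \<open>p\<close>, and rho_0 rho_1 rho_0 moves it by a
  walk of two edges, so parity is an invariant; the point is that it is a complete one. An
  automorphism fixing the base flag of type \<open>K\<close> lies in \<open>H K\<close> iff it moves
  \<open>p\<close> by an even walk inside the residue of that flag. The walk has to stay in the
  residue, which explains the form of the non-bipartite geometry: there H(G) is all of G, but H(G)_i
  can have index two in the stabilizer of the base element of type i, and the class attached to that
  element records the difference. In the bipartite case the colours already cut out the classes of
  every residue graph, so no class is recorded. Type 1 turns from edges into vertices because
  conjugation by rho_0 interchanges the first two halving generators, which makes H(G)_1 the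
  stabilizer of \<open>q\<close>.\<close>

lemma isomorphic_sym:
  assumes "isomorphic \<Gamma> \<Delta>"
  shows "isomorphic \<Delta> \<Gamma>"
proof -
  obtain f where f: "bij_betw f (elems \<Gamma>) (elems \<Delta>)" "\<forall>x \<in> elems \<Gamma>. ty \<Delta> (f x) = ty \<Gamma> x"
    "\<forall>x \<in> elems \<Gamma>. \<forall>y \<in> elems \<Gamma>. incident \<Delta> (f x) (f y) \<longleftrightarrow> incident \<Gamma> x y"
    and T: "typeset \<Gamma> = typeset \<Delta>"
    using assms unfolding isomorphic_def by blast
  define g where "g = inv_into (elems \<Gamma>) f"
  have g: "bij_betw g (elems \<Delta>) (elems \<Gamma>)"
    unfolding g_def by (rule bij_betw_inv_into[OF f(1)])
  have gE: "g y \<in> elems \<Gamma>" and fg: "f (g y) = y" if "y \<in> elems \<Delta>" for y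
    using that g bij_betw_inv_into_right[OF f(1)] unfolding g_def by (auto simp: bij_betw_apply)
  show ?thesis
    unfolding isomorphic_def
    using T g f(2,3) gE fg by (intro conjI exI[of _ g]) (auto, metis+)
qed

lemma isomorphic_trans:
  assumes "isomorphic \<Gamma> \<Delta>" and "isomorphic \<Delta> \<Theta>"
  shows "isomorphic \<Gamma> \<Theta>"
proof -
  obtain f where f: "bij_betw f (elems \<Gamma>) (elems \<Delta>)" "\<forall>x \<in> elems \<Gamma>. ty \<Delta> (f x) = ty \<Gamma> x"
    "\<forall>x \<in> elems \<Gamma>. \<forall>y \<in> elems \<Gamma>. incident \<Delta> (f x) (f y) \<longleftrightarrow> incident \<Gamma> x y"
    using assms unfolding isomorphic_def by blast
  obtain g where g: "bij_betw g (elems \<Delta>) (elems \<Theta>)" "\<forall>x \<in> elems \<Delta>. ty \<Theta> (g x) = ty \<Delta> x"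
    "\<forall>x \<in> elems \<Delta>. \<forall>y \<in> elems \<Delta>. incident \<Theta> (g x) (g y) \<longleftrightarrow> incident \<Delta> x y"
    using assms unfolding isomorphic_def by blast
  have "\<forall>x \<in> elems \<Gamma>. f x \<in> elems \<Delta>"
    using f(1) by (auto simp: bij_betw_apply)
  then show ?thesis
    using assms f(2,3) g(2,3) bij_betw_trans[OF f(1) g(1)] unfolding isomorphic_def
    by (intro conjI exI[of _ "g \<circ> f"]) auto
qed

text \<open>The isomorphism sends an element \<open>x\<close> of type \<open>i\<close> to the coset of all group elements that
  move \<open>x\<close> to the base element of type \<open>i\<close>.\<close>

lemma coset_geometry_isomorphic:
  fixes K :: "('g, 'm) monoid_scheme" and \<Delta> :: "('b, 'i) incidence_structure"
    and act :: "'g \<Rightarrow> 'b \<Rightarrow> 'b" and b :: "'i \<Rightarrow> 'b"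
  assumes "group K" and "typeset \<Delta> = I"
    and ty_in: "\<And>x. x \<in> elems \<Delta> \<Longrightarrow> ty \<Delta> x \<in> I"
    and refl: "\<And>x. x \<in> elems \<Delta> \<Longrightarrow> incident \<Delta> x x"
    and act_mult: "\<And>g h x. \<lbrakk>g \<in> carrier K; h \<in> carrier K; x \<in> elems \<Delta>\<rbrakk> \<Longrightarrow>
      act (g \<otimes>\<^bsub>K\<^esub> h) x = act g (act h x)"
    and act_one: "\<And>x. x \<in> elems \<Delta> \<Longrightarrow> act \<one>\<^bsub>K\<^esub> x = x"
    and act_elems: "\<And>g x. \<lbrakk>g \<in> carrier K; x \<in> elems \<Delta>\<rbrakk> \<Longrightarrow> act g x \<in> elems \<Delta>"
    and act_ty: "\<And>g x. \<lbrakk>g \<in> carrier K; x \<in> elems \<Delta>\<rbrakk> \<Longrightarrow> ty \<Delta> (act g x) = ty \<Delta> x"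
    and act_inc: "\<And>g x y. \<lbrakk>g \<in> carrier K; x \<in> elems \<Delta>; y \<in> elems \<Delta>; incident \<Delta> x y\<rbrakk> \<Longrightarrow>
      incident \<Delta> (act g x) (act g y)"
    and base: "\<And>i. i \<in> I \<Longrightarrow> b i \<in> elems \<Delta>" "\<And>i. i \<in> I \<Longrightarrow> ty \<Delta> (b i) = i"
    and base_inc: "\<And>i j. \<lbrakk>i \<in> I; j \<in> I\<rbrakk> \<Longrightarrow> incident \<Delta> (b i) (b j)"
    and stab: "\<And>i. i \<in> I \<Longrightarrow> Ks i = {g \<in> carrier K. act g (b i) = b i}"
    and trans: "\<And>x y. \<lbrakk>x \<in> elems \<Delta>; y \<in> elems \<Delta>; incident \<Delta> x y\<rbrakk> \<Longrightarrow>
      \<exists>g \<in> carrier K. act g (b (ty \<Delta> x)) = x \<and> act g (b (ty \<Delta> y)) = y"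
  shows "isomorphic (coset_geometry K I Ks) \<Delta>"
proof -
  interpret K: group K by fact
  \<comment> \<open>A product acts with its right factor first, so multiplying on the left by the
    stabilizer of a base element keeps an automorphism inside \<open>T x\<close>. This is why right
    cosets occur.\<close>
  define T where "T x = {g \<in> carrier K. act g x = b (ty \<Delta> x)}" for x
  have inv_act: "act (inv\<^bsub>K\<^esub> g) (act g x) = x" "act g (act (inv\<^bsub>K\<^esub> g) x) = x"
    if "g \<in> carrier K" "x \<in> elems \<Delta>" for g x
    using that act_mult[of "inv\<^bsub>K\<^esub> g" g x] act_mult[of g "inv\<^bsub>K\<^esub> g" x] act_one by auto
  have inj_act: "x = y" if "g \<in> carrier K" "x \<in> elems \<Delta>" "y \<in> elems \<Delta>" "act g x = act g y" for g x y
    using inv_act(1)[OF that(1,2)] inv_act(1)[OF that(1,3)] that(4) by metis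
  \<comment> \<open>A common member of the two cosets moves both elements to base elements, which
    are incident; its inverse pulls this incidence back. Conversely, transitivity on incident pairs
    supplies such a member.\<close>
  have common: "(\<exists>g \<in> carrier K. act g x = b (ty \<Delta> x) \<and> act g y = b (ty \<Delta> y)) \<longleftrightarrow> incident \<Delta> x y"
    if xy: "x \<in> elems \<Delta>" "y \<in> elems \<Delta>" for x y
  proof
    assume "\<exists>g \<in> carrier K. act g x = b (ty \<Delta> x) \<and> act g y = b (ty \<Delta> y)"
    then obtain g where g: "g \<in> carrier K" "act g x = b (ty \<Delta> x)" "act g y = b (ty \<Delta> y)" by blast
    have "incident \<Delta> (act g x) (act g y)" using g base_inc ty_in xy by simp
    then show "incident \<Delta> x y"
      using act_inc[of "inv\<^bsub>K\<^esub> g" "act g x" "act g y"] g(1) xy act_elems inv_act by simp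
  next
    assume "incident \<Delta> x y"
    then obtain g where g: "g \<in> carrier K" "act g (b (ty \<Delta> x)) = x" "act g (b (ty \<Delta> y)) = y"
      using trans xy by blast
    then show "\<exists>g \<in> carrier K. act g x = b (ty \<Delta> x) \<and> act g y = b (ty \<Delta> y)"
      using inv_act(1) base(1) ty_in xy by (metis K.inv_closed)
  qed
  have T_ne: "\<exists>g. g \<in> T x" if "x \<in> elems \<Delta>" for x
    using common[of x x] refl that unfolding T_def by blast
  have T_coset: "T x = Ks (ty \<Delta> x) #>\<^bsub>K\<^esub> g" if x: "x \<in> elems \<Delta>" and g: "g \<in> T x" for x g
  proof -
    let ?i = "ty \<Delta> x"
    have gK: "g \<in> carrier K" and gx: "act g x = b ?i" using g unfolding T_def by auto
    have "h \<in> T x \<longleftrightarrow> (\<exists>k \<in> Ks ?i. h = k \<otimes>\<^bsub>K\<^esub> g)" for h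
    proof
      assume h: "h \<in> T x"
      have "act (inv\<^bsub>K\<^esub> g) (b ?i) = x" using inv_act(1)[OF gK x] gx by simp
      then have "act (h \<otimes>\<^bsub>K\<^esub> inv\<^bsub>K\<^esub> g) (b ?i) = b ?i"
        using h gK act_mult[of h "inv\<^bsub>K\<^esub> g" "b ?i"] base ty_in[OF x] unfolding T_def by simp
      then have "h \<otimes>\<^bsub>K\<^esub> inv\<^bsub>K\<^esub> g \<in> Ks ?i"
        using stab ty_in x h gK unfolding T_def by auto
      moreover have "h = (h \<otimes>\<^bsub>K\<^esub> inv\<^bsub>K\<^esub> g) \<otimes>\<^bsub>K\<^esub> g"
        using h gK unfolding T_def by (simp add: K.m_assoc)
      ultimately show "\<exists>k \<in> Ks ?i. h = k \<otimes>\<^bsub>K\<^esub> g" by blast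
    next
      assume "\<exists>k \<in> Ks ?i. h = k \<otimes>\<^bsub>K\<^esub> g"
      then show "h \<in> T x"
        using stab ty_in x gK gx act_mult unfolding T_def by auto
    qed
    then show ?thesis unfolding r_coset_def by auto
  qed
  have eq_iff: "T x = T y \<longleftrightarrow> x = y" if xy: "x \<in> elems \<Delta>" "y \<in> elems \<Delta>" "ty \<Delta> x = ty \<Delta> y" for x y
  proof
    assume "T x = T y"
    then obtain g where "g \<in> T x" "g \<in> T y" using T_ne xy by blast
    then show "x = y" using inj_act xy unfolding T_def by auto
  qed simp
  \<comment> \<open>Cosets of one type are incident only when equal. The same holds in
    \<open>\<Delta>\<close> by transitivity, as one group element carries one base element to both
    \<open>x\<close> and \<open>y\<close>.\<close>
  have inc_eq: "incident \<Delta> x y \<longleftrightarrow> x = y" if xy: "x \<in> elems \<Delta>" "y \<in> elems \<Delta>" "ty \<Delta> x = ty \<Delta> y" for x y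
    using trans[OF xy(1,2)] refl xy by auto
  have inc_T: "T x \<inter> T y \<noteq> {} \<longleftrightarrow> incident \<Delta> x y" if "x \<in> elems \<Delta>" "y \<in> elems \<Delta>" for x y
    using common[OF that] unfolding T_def by blast
  define f where "f x = (ty \<Delta> x, T x)" for x
  have "f ` elems \<Delta> = elems (coset_geometry K I Ks)"
  proof
    show "f ` elems \<Delta> \<subseteq> elems (coset_geometry K I Ks)"
    proof
      fix z assume "z \<in> f ` elems \<Delta>"
      then obtain x where x: "x \<in> elems \<Delta>" "z = (ty \<Delta> x, T x)" unfolding f_def by blast
      obtain g where g: "g \<in> T x" using T_ne x by blast
      then show "z \<in> elems (coset_geometry K I Ks)"
        using x T_coset[OF x(1) g] ty_in[OF x(1)] unfolding coset_geometry_def T_def by auto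
    qed
    show "elems (coset_geometry K I Ks) \<subseteq> f ` elems \<Delta>"
    proof
      fix z assume "z \<in> elems (coset_geometry K I Ks)"
      then obtain i g where z: "z = (i, Ks i #>\<^bsub>K\<^esub> g)" "i \<in> I" "g \<in> carrier K"
        unfolding coset_geometry_def by auto
      let ?x = "act (inv\<^bsub>K\<^esub> g) (b i)"
      have x: "?x \<in> elems \<Delta>" "ty \<Delta> ?x = i" using z act_elems act_ty base by auto
      have "g \<in> T ?x" unfolding T_def using z x inv_act base by auto
      then have "f ?x = z" using T_coset[of ?x g] x z unfolding f_def by simp
      then show "z \<in> f ` elems \<Delta>" using x by blast
    qed
  qed
  moreover have "inj_on f (elems \<Delta>)"
    using eq_iff unfolding f_def inj_on_def by auto
  ultimately have "bij_betw f (elems \<Delta>) (elems (coset_geometry K I Ks))"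
    unfolding bij_betw_def by blast
  then have "isomorphic \<Delta> (coset_geometry K I Ks)"
    unfolding isomorphic_def using \<open>typeset \<Delta> = I\<close> eq_iff inc_eq inc_T
    by (intro conjI exI[of _ f]) (auto simp: coset_geometry_def f_def)
  then show ?thesis by (rule isomorphic_sym)
qed

section \<open>The automorphism group of an incidence structure\<close>

lemma subgroup_automorphisms:
  "subgroup (automorphisms \<Gamma>) (BijGroup (elems \<Gamma>))"
proof -
  interpret B: group "BijGroup (elems \<Gamma>)" by (rule group_BijGroup)
  show ?thesis
  proof (rule B.subgroupI)
    show "automorphisms \<Gamma> \<subseteq> carrier (BijGroup (elems \<Gamma>))"
      by (auto simp: automorphisms_def BijGroup_def)
    have "restrict (\<lambda>x. x) (elems \<Gamma>) \<in> automorphisms \<Gamma>"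
      by (auto simp: automorphisms_def id_Bij)
    then show "automorphisms \<Gamma> \<noteq> {}" by blast
  next
    fix g assume g: "g \<in> automorphisms \<Gamma>"
    then have gB: "g \<in> Bij (elems \<Gamma>)" by (simp add: automorphisms_def)
    then have bij: "bij_betw g (elems \<Gamma>) (elems \<Gamma>)" by (simp add: Bij_def)
    let ?h = "restrict (inv_into (elems \<Gamma>) g) (elems \<Gamma>)"
    have h: "?h x \<in> elems \<Gamma>" "g (?h x) = x" if "x \<in> elems \<Gamma>" for x
      using that bij bij_betw_inv_into_right[OF bij] bij_betw_apply[OF bij_betw_inv_into[OF bij]]
      by auto
    have "?h \<in> automorphisms \<Gamma>"
      using g h restrict_inv_into_Bij[OF gB] unfolding automorphisms_def
      by (intro CollectI conjI ballI) (auto, metis+)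
    then show "inv\<^bsub>BijGroup (elems \<Gamma>)\<^esub> g \<in> automorphisms \<Gamma>"
      using inv_BijGroup[OF gB] by simp
  next
    fix g h assume "g \<in> automorphisms \<Gamma>" "h \<in> automorphisms \<Gamma>"
    moreover from this have "x \<in> elems \<Gamma> \<Longrightarrow> h x \<in> elems \<Gamma>" for x
      by (auto simp: automorphisms_def Bij_def bij_betw_apply)
    ultimately show "g \<otimes>\<^bsub>BijGroup (elems \<Gamma>)\<^esub> h \<in> automorphisms \<Gamma>"
      by (auto simp: automorphisms_def BijGroup_def compose_Bij compose_eq)
  qed
qed

lemma group_Aut: "group (Aut \<Gamma>)"
  unfolding Aut_def
  by (rule group.subgroup_imp_group[OF group_BijGroup subgroup_automorphisms])

section \<open>Chambers and flag stabilizers of a regular hypertope\<close>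

text \<open>Serves both for thinness, where the set holds the two completions of a panel to a
  chamber, and for (B_1), where it holds the two ends of an edge.\<close>

lemma card_2_other: "\<lbrakk>card A = 2; a \<in> A; b \<in> A; c \<in> A; b \<noteq> a; c \<noteq> a\<rbrakk> \<Longrightarrow> b = c"
  by (auto simp: card_2_iff)

locale based_hypertope =
  fixes \<Gamma> :: "('a, 'i) incidence_structure" and C :: "'a set"
  assumes hypertope: "regular_hypertope \<Gamma>" and chamber_C: "chamber \<Gamma> C"
begin

abbreviation "E \<equiv> elems \<Gamma>"
abbreviation "G \<equiv> carrier (Aut \<Gamma>)"
abbreviation mul (infixl "\<cdot>" 70) where "g \<cdot> h \<equiv> g \<otimes>\<^bsub>Aut \<Gamma>\<^esub> h"
abbreviation r where "r \<equiv> rho \<Gamma> C"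

definition c :: "'i \<Rightarrow> 'a" where "c i = (THE x. x \<in> C \<and> ty \<Gamma> x = i)"

sublocale aut: group "Aut \<Gamma>" by (rule group_Aut)

lemma geometry: "incidence_geometry \<Gamma>" and thin: "thin \<Gamma>"
  and residually_connected: "residually_connected \<Gamma>" and flag_transitive: "flag_transitive \<Gamma>"
  using hypertope by (auto simp: regular_hypertope_def)

lemma finite_types: "finite (typeset \<Gamma>)"
  and ty_in: "x \<in> E \<Longrightarrow> ty \<Gamma> x \<in> typeset \<Gamma>"
  and inc_refl: "x \<in> E \<Longrightarrow> incident \<Gamma> x x"
  and inc_sym: "\<lbrakk>x \<in> E; y \<in> E; incident \<Gamma> x y\<rbrakk> \<Longrightarrow> incident \<Gamma> y x"
  and inc_ty_eq: "\<lbrakk>x \<in> E; y \<in> E; incident \<Gamma> x y; ty \<Gamma> x = ty \<Gamma> y\<rbrakk> \<Longrightarrow> x = y"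
  using geometry unfolding incidence_geometry_def incidence_system_def by blast+

lemma flag_in_chamber: "flag \<Gamma> F \<Longrightarrow> \<exists>D. chamber \<Gamma> D \<and> F \<subseteq> D"
  using geometry unfolding incidence_geometry_def by blast

lemma flag_empty: "flag \<Gamma> {}"
  by (simp add: flag_def)

lemma flag_insert:
  assumes "flag \<Gamma> F" "x \<in> E" "\<And>y. y \<in> F \<Longrightarrow> incident \<Gamma> x y"
  shows "flag \<Gamma> (insert x F)"
  using assms inc_refl inc_sym unfolding flag_def by (auto simp: subset_iff)

lemma flag_subset: "\<lbrakk>flag \<Gamma> F; F' \<subseteq> F\<rbrakk> \<Longrightarrow> flag \<Gamma> F'"
  unfolding flag_def by blast

lemma chamber_flag: "chamber \<Gamma> D \<Longrightarrow> flag \<Gamma> D"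
  by (simp add: chamber_def)

lemma chamber_elems: "\<lbrakk>chamber \<Gamma> D; x \<in> D\<rbrakk> \<Longrightarrow> x \<in> E"
  by (auto simp: chamber_def flag_def)

lemma chamber_inc: "\<lbrakk>chamber \<Gamma> D; x \<in> D; y \<in> D\<rbrakk> \<Longrightarrow> incident \<Gamma> x y"
  by (auto simp: chamber_def flag_def)

lemma chamber_ty_inj: "\<lbrakk>chamber \<Gamma> D; x \<in> D; y \<in> D; ty \<Gamma> x = ty \<Gamma> y\<rbrakk> \<Longrightarrow> x = y"
  using inc_ty_eq chamber_inc chamber_elems by blast

lemma chamber_ex: "\<lbrakk>chamber \<Gamma> D; i \<in> typeset \<Gamma>\<rbrakk> \<Longrightarrow> \<exists>x\<in>D. ty \<Gamma> x = i"
  by (metis chamber_def imageE)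

lemma c_C: "c i \<in> C" and ty_c [simp]: "ty \<Gamma> (c i) = i" if "i \<in> typeset \<Gamma>"
proof -
  have "\<exists>!x. x \<in> C \<and> ty \<Gamma> x = i"
    using chamber_ex[OF chamber_C that] chamber_ty_inj[OF chamber_C] by blast
  then have "c i \<in> C \<and> ty \<Gamma> (c i) = i" unfolding c_def by (rule theI')
  then show "c i \<in> C" "ty \<Gamma> (c i) = i" by auto
qed

lemma c_E [simp]: "i \<in> typeset \<Gamma> \<Longrightarrow> c i \<in> E"
  using c_C chamber_elems chamber_C by blast

lemma c_inc [simp]: "\<lbrakk>i \<in> typeset \<Gamma>; j \<in> typeset \<Gamma>\<rbrakk> \<Longrightarrow> incident \<Gamma> (c i) (c j)"
  using c_C chamber_inc chamber_C by blast

lemma C_eq: "x \<in> C \<Longrightarrow> x = c (ty \<Gamma> x)"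
  by (metis c_C chamber_C chamber_elems chamber_ty_inj ty_c ty_in)

section \<open>The action of automorphisms on elements, flags and chambers\<close>

lemma mul_apply [simp]: "\<lbrakk>g \<in> G; h \<in> G; x \<in> E\<rbrakk> \<Longrightarrow> (g \<cdot> h) x = g (h x)"
  by (auto simp: Aut_def automorphisms_def BijGroup_def compose_eq)

lemma one_apply [simp]: "x \<in> E \<Longrightarrow> \<one>\<^bsub>Aut \<Gamma>\<^esub> x = x"
  by (simp add: Aut_def BijGroup_def)

lemma aut_ext: "\<lbrakk>g \<in> G; h \<in> G; \<And>x. x \<in> E \<Longrightarrow> g x = h x\<rbrakk> \<Longrightarrow> g = h"
  by (auto simp: Aut_def automorphisms_def Bij_def intro: extensionalityI)

lemma autE [simp]: "\<lbrakk>g \<in> G; x \<in> E\<rbrakk> \<Longrightarrow> g x \<in> E"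
  and aut_ty [simp]: "\<lbrakk>g \<in> G; x \<in> E\<rbrakk> \<Longrightarrow> ty \<Gamma> (g x) = ty \<Gamma> x"
  and aut_inc [simp]: "\<lbrakk>g \<in> G; x \<in> E; y \<in> E\<rbrakk> \<Longrightarrow> incident \<Gamma> (g x) (g y) = incident \<Gamma> x y"
  and aut_inj: "\<lbrakk>g \<in> G; x \<in> E; y \<in> E; g x = g y\<rbrakk> \<Longrightarrow> x = y"
  by (auto simp: Aut_def automorphisms_def Bij_def bij_betw_def inj_on_def)

lemma inv_apply [simp]:
  assumes "g \<in> G" "x \<in> E"
  shows "(inv\<^bsub>Aut \<Gamma>\<^esub> g) (g x) = x" and "g ((inv\<^bsub>Aut \<Gamma>\<^esub> g) x) = x"
  using mul_apply[of "inv\<^bsub>Aut \<Gamma>\<^esub> g" g x] mul_apply[of g "inv\<^bsub>Aut \<Gamma>\<^esub> g" x] assms by auto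

lemma inv_apply_eq:
  assumes "g \<in> G" "x \<in> E" "g x = y"
  shows "(inv\<^bsub>Aut \<Gamma>\<^esub> g) y = x"
  using assms by auto

lemma flag_image: "\<lbrakk>g \<in> G; flag \<Gamma> F\<rbrakk> \<Longrightarrow> flag \<Gamma> (g ` F)"
  unfolding flag_def by (auto simp: subset_iff)

lemma ty_image: "\<lbrakk>g \<in> G; F \<subseteq> E\<rbrakk> \<Longrightarrow> ty \<Gamma> ` g ` F = ty \<Gamma> ` F"
  by (force simp: subset_iff image_iff)

lemma chamber_image: "\<lbrakk>g \<in> G; chamber \<Gamma> D\<rbrakk> \<Longrightarrow> chamber \<Gamma> (g ` D)"
  using flag_image ty_image unfolding chamber_def flag_def by metis

lemma flag_c: "J \<subseteq> typeset \<Gamma> \<Longrightarrow> flag \<Gamma> (c ` J)"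
  by (auto simp: flag_def subset_iff)

text \<open>Flag transitivity matches flags only as sets. Automorphisms preserve types and a flag
  has at most one element of each type, so the elements are matched one by one.\<close>

lemma flag_trans:
  assumes "flag \<Gamma> F"
  shows "\<exists>g\<in>G. \<forall>x\<in>F. g (c (ty \<Gamma> x)) = x"
proof -
  have FE: "F \<subseteq> E" using assms by (simp add: flag_def)
  then have J: "ty \<Gamma> ` F \<subseteq> typeset \<Gamma>" using ty_in by blast
  let ?F = "c ` ty \<Gamma> ` F"
  have "ty \<Gamma> ` ?F = ty \<Gamma> ` F" using J by (force simp: image_iff)
  then obtain g where g: "g \<in> G" "g ` ?F = F"
    using flag_transitive assms flag_c[OF J] unfolding flag_transitive_def by blast
  have "g (c (ty \<Gamma> x)) = x" if "x \<in> F" for x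
  proof -
    have "g (c (ty \<Gamma> x)) \<in> F" using g that by blast
    moreover have "ty \<Gamma> (g (c (ty \<Gamma> x))) = ty \<Gamma> x" using J that g by auto
    ultimately show ?thesis using assms that FE inc_ty_eq unfolding flag_def by blast
  qed
  then show ?thesis using g by blast
qed

section \<open>Panels and adjacent chambers\<close>

lemma i_adjacent_type:
  assumes "i_adjacent \<Gamma> i D D'"
  shows "i \<in> typeset \<Gamma>"
proof (rule ccontr)
  assume "i \<notin> typeset \<Gamma>"
  then have "{x \<in> D. ty \<Gamma> x \<noteq> i} = D" "{x \<in> D'. ty \<Gamma> x \<noteq> i} = D'"
    using assms ty_in chamber_elems unfolding i_adjacent_def by blast+
  moreover have "D \<noteq> D'" "{x \<in> D. ty \<Gamma> x \<noteq> i} = {x \<in> D'. ty \<Gamma> x \<noteq> i}"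
    using assms unfolding i_adjacent_def by blast+
  ultimately show False by metis
qed

lemma chamber_minus:
  assumes "chamber \<Gamma> D" "d \<in> D"
  shows "D = insert d {x \<in> D. ty \<Gamma> x \<noteq> ty \<Gamma> d}"
  using assms chamber_ty_inj by blast

text \<open>Thinness applies since a chamber without its element of type \<open>i\<close> leaves a
  single type in its residue. The elements of that residue are the possible completions of the panel
  to a chamber.\<close>

lemma panel_residue:
  assumes D: "chamber \<Gamma> D" and i: "i \<in> typeset \<Gamma>"
  defines "F \<equiv> {x \<in> D. ty \<Gamma> x \<noteq> i}"
  shows "card (elems (residue \<Gamma> F)) = 2"
    and "\<And>D' x. \<lbrakk>chamber \<Gamma> D'; F \<subseteq> D'; x \<in> D'; ty \<Gamma> x = i\<rbrakk> \<Longrightarrow> x \<in> elems (residue \<Gamma> F)"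
    and "\<And>x. x \<in> elems (residue \<Gamma> F) \<Longrightarrow> chamber \<Gamma> (insert x F) \<and> ty \<Gamma> x = i"
proof -
  have tyF: "ty \<Gamma> ` F = typeset \<Gamma> - {i}"
    using D unfolding F_def chamber_def by auto
  have flF: "flag \<Gamma> F" using flag_subset[OF chamber_flag[OF D]] unfolding F_def by auto
  have "typeset (residue \<Gamma> F) = {i}" using tyF i by (auto simp: residue_def)
  then show "card (elems (residue \<Gamma> F)) = 2"
    using thin flF unfolding thin_def by auto
  show "x \<in> elems (residue \<Gamma> F)" if "chamber \<Gamma> D'" "F \<subseteq> D'" "x \<in> D'" "ty \<Gamma> x = i" for D' x
    using that chamber_elems chamber_inc unfolding residue_def F_def by auto
  show "chamber \<Gamma> (insert x F) \<and> ty \<Gamma> x = i" if x: "x \<in> elems (residue \<Gamma> F)" for x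
  proof -
    have x': "x \<in> E" "x \<notin> F" "\<forall>y\<in>F. incident \<Gamma> x y" using x by (auto simp: residue_def)
    have "ty \<Gamma> x = i"
    proof (rule ccontr)
      assume "ty \<Gamma> x \<noteq> i"
      then have "ty \<Gamma> x \<in> ty \<Gamma> ` F" using tyF ty_in x' by blast
      then obtain y where "y \<in> F" "ty \<Gamma> y = ty \<Gamma> x" by auto
      then show False using x' inc_ty_eq flF unfolding flag_def by (metis subsetD)
    qed
    then show ?thesis
      using flag_insert[OF flF x'(1)] x' tyF i unfolding chamber_def by auto
  qed
qed

text \<open>The elements of type \<open>i\<close> of all three chambers lie in the two-element
  residue of their common panel; those of \<open>D1\<close> and \<open>D2\<close> differ from that
  of \<open>D\<close>, so they agree.\<close>

lemma i_adjacent_unique: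
  assumes "i_adjacent \<Gamma> i D D1" "i_adjacent \<Gamma> i D D2"
  shows "D1 = D2"
proof -
  have i: "i \<in> typeset \<Gamma>" using assms i_adjacent_type by blast
  define F where "F = {x \<in> D. ty \<Gamma> x \<noteq> i}"
  have ch: "chamber \<Gamma> D" "chamber \<Gamma> D1" "chamber \<Gamma> D2"
    and F: "{x \<in> D1. ty \<Gamma> x \<noteq> i} = F" "{x \<in> D2. ty \<Gamma> x \<noteq> i} = F" and ne: "D1 \<noteq> D" "D2 \<noteq> D"
    using assms unfolding i_adjacent_def F_def by auto
  obtain d d1 d2 where d: "d \<in> D" "ty \<Gamma> d = i" "d1 \<in> D1" "ty \<Gamma> d1 = i" "d2 \<in> D2" "ty \<Gamma> d2 = i"
    using chamber_ex[OF _ i] ch by metis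
  have eq: "D = insert d F" "D1 = insert d1 F" "D2 = insert d2 F"
    using chamber_minus[OF ch(1) d(1)] chamber_minus[OF ch(2) d(3)] chamber_minus[OF ch(3) d(5)] d F
    by (simp_all add: F_def)
  note res = panel_residue[OF ch(1) i, folded F_def]
  have "F \<subseteq> D" "F \<subseteq> D1" "F \<subseteq> D2" using eq by blast+
  then have "d \<in> elems (residue \<Gamma> F)" "d1 \<in> elems (residue \<Gamma> F)" "d2 \<in> elems (residue \<Gamma> F)"
    using res(2)[OF ch(1) _ d(1,2)] res(2)[OF ch(2) _ d(3,4)] res(2)[OF ch(3) _ d(5,6)] by blast+
  moreover have "d1 \<noteq> d" "d2 \<noteq> d" using eq ne by auto
  ultimately have "d1 = d2" using card_2_other[OF res(1)] by metis
  then show ?thesis using eq by simp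
qed

lemma i_adjacent_ex:
  assumes D: "chamber \<Gamma> D" and i: "i \<in> typeset \<Gamma>"
  shows "\<exists>D'. i_adjacent \<Gamma> i D D'"
proof -
  let ?F = "{x \<in> D. ty \<Gamma> x \<noteq> i}"
  obtain d where d: "d \<in> D" "ty \<Gamma> d = i" using chamber_ex[OF D i] by blast
  obtain a b where ab: "elems (residue \<Gamma> ?F) = {a, b}" "a \<noteq> b"
    using panel_residue(1)[OF D i] by (meson card_2_iff)
  then obtain x where x: "x \<in> elems (residue \<Gamma> ?F)" "x \<noteq> d" by blast
  have "chamber \<Gamma> (insert x ?F)" "ty \<Gamma> x = i" using panel_residue(3)[OF D i x(1)] by auto
  moreover have "x \<notin> D" using x d chamber_ty_inj[OF D] calculation(2) by blast
  ultimately have "i_adjacent \<Gamma> i D (insert x ?F)"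
    unfolding i_adjacent_def using D by auto
  then show ?thesis ..
qed

lemma i_adjacent_image:
  assumes g: "g \<in> G" and adj: "i_adjacent \<Gamma> i D D'"
  shows "i_adjacent \<Gamma> i (g ` D) (g ` D')"
proof -
  have D: "chamber \<Gamma> D" "chamber \<Gamma> D'" using adj by (auto simp: i_adjacent_def)
  have DE: "D \<subseteq> E" "D' \<subseteq> E" using D chamber_elems by auto
  have "inj_on g E" using g aut_inj by (auto simp: inj_on_def)
  then have "g ` D \<noteq> g ` D'"
    using adj DE by (auto simp: i_adjacent_def inj_on_image_eq_iff)
  moreover have im: "{x \<in> g ` A. ty \<Gamma> x \<noteq> i} = g ` {x \<in> A. ty \<Gamma> x \<noteq> i}" if "A \<subseteq> E" for A
    using g that by (auto simp: subset_iff image_iff)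
  have "{x \<in> g ` D. ty \<Gamma> x \<noteq> i} = {x \<in> g ` D'. ty \<Gamma> x \<noteq> i}"
    using adj im[OF DE(1)] im[OF DE(2)] unfolding i_adjacent_def by simp
  ultimately show ?thesis
    using D g chamber_image unfolding i_adjacent_def by auto
qed

section \<open>Galleries through a fixed flag\<close>

definition gallery_step :: "'a set \<Rightarrow> 'a set \<Rightarrow> 'a set \<Rightarrow> bool" where
  "gallery_step F D D' \<longleftrightarrow> F \<subseteq> D \<and> F \<subseteq> D' \<and> (\<exists>i. i_adjacent \<Gamma> i D D')"

lemma gallery_step_mono: "F \<subseteq> F' \<Longrightarrow> gallery_step F' \<le> gallery_step F"
  unfolding gallery_step_def by auto

text \<open>Residual connectedness yields paths of elements, not of chambers. Two consecutive
  elements of a path in the residue of \<open>F\<close> lie with \<open>F\<close> in one chamber,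
  and chambers sharing an element beyond \<open>F\<close> are linked by induction on the corank. If
  at most one type is left, chambers over \<open>F\<close> are equal or adjacent.\<close>

lemma gallery_connected:
  assumes "flag \<Gamma> F" "chamber \<Gamma> D" "chamber \<Gamma> D'" "F \<subseteq> D" "F \<subseteq> D'"
  shows "(gallery_step F)\<^sup>*\<^sup>* D D'"
  using assms
proof (induction "card (typeset \<Gamma> - ty \<Gamma> ` F)" arbitrary: F D D' rule: less_induct)
  case less
  note fl = less.prems(1) and D = less.prems(2) and D' = less.prems(3)
    and FD = less.prems(4) and FD' = less.prems(5)
  let ?R = "typeset \<Gamma> - ty \<Gamma> ` F"
  have via: "(gallery_step F)\<^sup>*\<^sup>* A B"
    if A: "chamber \<Gamma> A" "F \<subseteq> A" "z \<in> A" and B: "chamber \<Gamma> B" "F \<subseteq> B" "z \<in> B" and z: "ty \<Gamma> z \<in> ?R"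
    for z A B
  proof -
    have "card (typeset \<Gamma> - ty \<Gamma> ` insert z F) < card ?R"
      by (rule psubset_card_mono) (use z finite_types in auto)
    moreover have "flag \<Gamma> (insert z F)" using A chamber_flag flag_subset by (metis insert_subset)
    ultimately have "(gallery_step (insert z F))\<^sup>*\<^sup>* A B" using less.hyps A B by blast
    then show ?thesis using rtranclp_mono[OF gallery_step_mono[of F "insert z F"]] by blast
  qed
  show ?case
  proof (cases "card ?R \<ge> 2")
    case True
    then have conn: "incidence_connected (residue \<Gamma> F)"
      using residually_connected fl unfolding residually_connected_def by (auto simp: residue_def)
    have "?R \<noteq> {}" using True by (metis card.empty not_numeral_le_zero)
    then obtain i where i: "i \<in> ?R" by blast
    obtain x y where x: "x \<in> D" "ty \<Gamma> x = i" and y: "y \<in> D'" "ty \<Gamma> y = i"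
      using chamber_ex D D' i by (metis DiffD1)
    have res: "z \<in> elems (residue \<Gamma> F) \<longleftrightarrow> z \<in> E \<and> z \<notin> F \<and> (\<forall>w\<in>F. incident \<Gamma> z w)" for z
      by (simp add: residue_def)
    have resR: "ty \<Gamma> z \<in> ?R" if z: "z \<in> elems (residue \<Gamma> F)" for z
      using z inc_ty_eq fl ty_in unfolding res flag_def by (auto simp: subset_iff) metis
    have resI: "z \<in> elems (residue \<Gamma> F)"
      if A: "chamber \<Gamma> A" "F \<subseteq> A" "z \<in> A" and z: "ty \<Gamma> z = i" for z A
    proof -
      have "z \<notin> F" using z i by blast
      then show ?thesis
        using chamber_elems[OF A(1,3)] chamber_inc[OF A(1,3)] A(2) unfolding res by blast
    qed
    have xr: "x \<in> elems (residue \<Gamma> F)" and yr: "y \<in> elems (residue \<Gamma> F)"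
      using resI[OF D FD x] resI[OF D' FD' y] by auto
    have "(\<lambda>u v. u \<in> elems (residue \<Gamma> F) \<and> v \<in> elems (residue \<Gamma> F) \<and> incident \<Gamma> u v)\<^sup>*\<^sup>* x y"
      using conn xr yr unfolding incidence_connected_def by (auto simp: residue_def)
    \<comment> \<open>All chambers through the end of the path are treated together, so that the
      chamber may be changed at each element of the path.\<close>
    then have "\<forall>B. chamber \<Gamma> B \<and> F \<subseteq> B \<and> y \<in> B \<longrightarrow> (gallery_step F)\<^sup>*\<^sup>* D B"
    proof (induction rule: rtranclp_induct)
      case base
      then show ?case using via[of D x] D FD x resR[OF xr] by blast
    next
      case (step u v)
      have uv: "u \<in> E" "v \<in> E" "incident \<Gamma> u v" "\<forall>w\<in>F. incident \<Gamma> u w" "\<forall>w\<in>F. incident \<Gamma> v w"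
        using step.hyps(2) res by auto
      have "flag \<Gamma> (insert u (insert v F))"
        using fl uv by (intro flag_insert) auto
      then obtain A where A: "chamber \<Gamma> A" "F \<subseteq> A" "u \<in> A" "v \<in> A"
        using flag_in_chamber by (metis insert_subset)
      then have "(gallery_step F)\<^sup>*\<^sup>* D A" using step.IH by blast
      moreover have "(gallery_step F)\<^sup>*\<^sup>* A B" if "chamber \<Gamma> B \<and> F \<subseteq> B \<and> v \<in> B" for B
        using via[of A v B] A that resR[of v] step.hyps(2) by blast
      ultimately show ?case by (meson rtranclp_trans)
    qed
    then show ?thesis using D' FD' y by blast
  next
    case False
    then have "card ?R \<le> Suc 0" by simp
    then have "\<forall>a\<in>?R. \<forall>b\<in>?R. a = b"
      using finite_types card_le_Suc0_iff_eq by blast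
    then obtain i where i: "?R \<subseteq> {i}" by blast
    have "A \<subseteq> F \<union> {x. ty \<Gamma> x = i}" if "chamber \<Gamma> A" "F \<subseteq> A" for A
    proof
      fix x assume x: "x \<in> A"
      show "x \<in> F \<union> {x. ty \<Gamma> x = i}"
      proof (cases "ty \<Gamma> x = i")
        case False
        then have "ty \<Gamma> x \<in> ty \<Gamma> ` F" using i ty_in chamber_elems x that by blast
        then obtain y where "y \<in> F" "ty \<Gamma> y = ty \<Gamma> x" by auto
        then show ?thesis using chamber_ty_inj[OF that(1) x] that(2) by (metis UnI1 subsetD)
      qed auto
    qed
    then have "{x \<in> D. ty \<Gamma> x \<noteq> i} = {x \<in> D'. ty \<Gamma> x \<noteq> i}"
      using D D' FD FD' by blast
    then have "D = D' \<or> gallery_step F D D'"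
      using D D' FD FD' unfolding gallery_step_def i_adjacent_def by blast
    then show ?thesis by auto
  qed
qed

text \<open>Agreement spreads along galleries: adjacent chambers are unique, so two automorphisms
  with the same image of one chamber have the same image of the next, and types then match the
  elements.\<close>

lemma aut_eqI:
  assumes g: "g \<in> G" and h: "h \<in> G" and eq: "\<And>i. i \<in> typeset \<Gamma> \<Longrightarrow> g (c i) = h (c i)"
  shows "g = h"
proof (rule aut_ext[OF g h])
  fix x assume x: "x \<in> E"
  then have "flag \<Gamma> {x}" using inc_refl by (auto simp: flag_def)
  then obtain D where D: "chamber \<Gamma> D" "x \<in> D" using flag_in_chamber by blast
  have "(gallery_step {})\<^sup>*\<^sup>* C D"
    using gallery_connected[OF flag_empty chamber_C D(1)] by blast
  then have "\<forall>y\<in>D. g y = h y"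
  proof (induction rule: rtranclp_induct)
    case base
    then show ?case using eq C_eq ty_in chamber_elems chamber_C by metis
  next
    case (step A B)
    then obtain i where adj: "i_adjacent \<Gamma> i A B" unfolding gallery_step_def by blast
    have B: "chamber \<Gamma> B" using adj by (simp add: i_adjacent_def)
    have "g ` A = h ` A" using step.IH by auto
    then have "g ` B = h ` B"
      using i_adjacent_unique i_adjacent_image[OF g adj] i_adjacent_image[OF h adj] by metis
    then show ?case
      using chamber_ty_inj[OF chamber_image[OF g B]] g h B chamber_elems by (metis aut_ty imageI)
  qed
  then show "g x = h x" using D by blast
qed

section \<open>The distinguished generators\<close>

text \<open>Replaces the definite description of \<open>rho\<close> by a test on base elements. A
  nontrivial \<open>g\<close> that fixes the others must move \<open>c i\<close>, so it sends
  \<open>C\<close> to its only \<open>i\<close>-adjacent chamber, and the image of \<open>C\<close>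
  determines the automorphism.\<close>

lemma rho_unique:
  assumes g: "g \<in> G" and i: "i \<in> typeset \<Gamma>" and ne: "g \<noteq> \<one>\<^bsub>Aut \<Gamma>\<^esub>"
    and fix_g: "\<And>j. \<lbrakk>j \<in> typeset \<Gamma>; j \<noteq> i\<rbrakk> \<Longrightarrow> g (c j) = c j"
  shows "g = r i"
proof -
  have "g (c i) \<noteq> c i"
    using aut_eqI[OF g aut.one_closed] fix_g ne by (metis c_E one_apply)
  moreover have "{x \<in> g ` C. ty \<Gamma> x \<noteq> i} = {x \<in> C. ty \<Gamma> x \<noteq> i}"
  proof -
    have gx: "g x = x" if "x \<in> C" "ty \<Gamma> x \<noteq> i" for x
      using fix_g C_eq that ty_in chamber_elems[OF chamber_C] by metis
    show ?thesis
    proof (intro equalityI subsetI)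
      fix y assume "y \<in> {x \<in> g ` C. ty \<Gamma> x \<noteq> i}"
      then obtain x where "x \<in> C" "y = g x" "ty \<Gamma> x \<noteq> i"
        using g chamber_elems[OF chamber_C] by auto
      then show "y \<in> {x \<in> C. ty \<Gamma> x \<noteq> i}" using gx by simp
    next
      fix x assume "x \<in> {x \<in> C. ty \<Gamma> x \<noteq> i}"
      then show "x \<in> {x \<in> g ` C. ty \<Gamma> x \<noteq> i}" using gx by (auto simp: image_iff) metis
    qed
  qed
  moreover have "c i \<notin> g ` C"
  proof
    assume "c i \<in> g ` C"
    then obtain x where x: "x \<in> C" "c i = g x" by blast
    then have "ty \<Gamma> x = i" using g i chamber_elems[OF chamber_C] by (metis aut_ty ty_c)
    then show False using \<open>g (c i) \<noteq> c i\<close> C_eq x by metis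
  qed
  ultimately have adj: "i_adjacent \<Gamma> i C (g ` C)"
    using chamber_C chamber_image[OF g] c_C[OF i] unfolding i_adjacent_def by auto
  have "h = g" if h: "h \<in> G" "i_adjacent \<Gamma> i C (h ` C)" for h
  proof (rule aut_eqI[OF h(1) g])
    fix j assume j: "j \<in> typeset \<Gamma>"
    have "h ` C = g ` C" using i_adjacent_unique adj h by blast
    then show "h (c j) = g (c j)"
      using chamber_ty_inj[OF chamber_image[OF g chamber_C]] c_C[OF j] j g h by (metis aut_ty c_E imageI)
  qed
  then show ?thesis unfolding rho_def using g adj by (intro the_equality[symmetric]) blast+
qed

text \<open>Existence comes from flag transitivity, which carries \<open>C\<close> to the
  \<open>i\<close>-adjacent chamber provided by thinness.\<close>

lemma rho:
  assumes i: "i \<in> typeset \<Gamma>"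
  shows "r i \<in> G" and "i_adjacent \<Gamma> i C (r i ` C)" and "r i \<noteq> \<one>\<^bsub>Aut \<Gamma>\<^esub>"
    and "\<And>j. \<lbrakk>j \<in> typeset \<Gamma>; j \<noteq> i\<rbrakk> \<Longrightarrow> r i (c j) = c j"
proof -
  obtain D where D: "i_adjacent \<Gamma> i C D" using i_adjacent_ex[OF chamber_C i] by blast
  then have chD: "chamber \<Gamma> D" by (simp add: i_adjacent_def)
  obtain g where g: "g \<in> G" "\<forall>x\<in>D. g (c (ty \<Gamma> x)) = x"
    using flag_trans[OF chamber_flag[OF chD]] by blast
  have gc: "g (c j) \<in> D" if "j \<in> typeset \<Gamma>" for j
    using chamber_ex[OF chD that] g by auto
  have "g ` C = D"
  proof
    show "g ` C \<subseteq> D" using gc C_eq ty_in chamber_elems[OF chamber_C] by (metis image_subsetI)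
    show "D \<subseteq> g ` C" using g c_C ty_in chamber_elems[OF chD] by (metis imageI subsetI)
  qed
  have gfix: "g (c j) = c j" if j: "j \<in> typeset \<Gamma>" "j \<noteq> i" for j
  proof -
    have "c j \<in> {x \<in> C. ty \<Gamma> x \<noteq> i}" using j c_C by auto
    then have "c j \<in> D" using D unfolding i_adjacent_def by blast
    then show ?thesis using g j by force
  qed
  have "g \<noteq> \<one>\<^bsub>Aut \<Gamma>\<^esub>"
  proof
    assume "g = \<one>\<^bsub>Aut \<Gamma>\<^esub>"
    then have "g ` C = C" using chamber_elems[OF chamber_C] by (auto simp: image_iff)
    then show False using D \<open>g ` C = D\<close> by (auto simp: i_adjacent_def)
  qed
  then have "g = r i" using rho_unique g i gfix by blast
  then show "r i \<in> G" "i_adjacent \<Gamma> i C (r i ` C)" "r i \<noteq> \<one>\<^bsub>Aut \<Gamma>\<^esub>"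
    "\<And>j. \<lbrakk>j \<in> typeset \<Gamma>; j \<noteq> i\<rbrakk> \<Longrightarrow> r i (c j) = c j"
    using g D \<open>g ` C = D\<close> \<open>g \<noteq> _\<close> gfix by auto
qed

lemma rho_moves:
  assumes i: "i \<in> typeset \<Gamma>"
  shows "r i (c i) \<noteq> c i"
proof
  assume "r i (c i) = c i"
  then have "r i (c j) = \<one>\<^bsub>Aut \<Gamma>\<^esub> (c j)" if "j \<in> typeset \<Gamma>" for j
    using rho(4)[OF i that] that by (cases "j = i") auto
  then show False using aut_eqI[OF rho(1)[OF i] aut.one_closed] rho(3)[OF i] by blast
qed

text \<open>The square fixes the same base elements as \<open>r i\<close>. If nontrivial it would
  equal \<open>r i\<close> by \<open>rho_unique\<close>, and cancelling would make
  \<open>r i\<close> trivial.\<close>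

lemma rho_square:
  assumes i: "i \<in> typeset \<Gamma>"
  shows "r i \<cdot> r i = \<one>\<^bsub>Aut \<Gamma>\<^esub>"
proof (rule ccontr)
  assume "r i \<cdot> r i \<noteq> \<one>\<^bsub>Aut \<Gamma>\<^esub>"
  moreover have "(r i \<cdot> r i) (c j) = c j" if "j \<in> typeset \<Gamma>" "j \<noteq> i" for j
    using rho(1)[OF i] rho(4)[OF i that] that by simp
  ultimately have "r i \<cdot> r i = r i"
    using rho_unique[OF _ i] rho(1)[OF i] by blast
  then show False using rho(1,3)[OF i] by (metis aut.l_cancel_one')
qed

lemma rho_rho [simp]: "\<lbrakk>i \<in> typeset \<Gamma>; x \<in> E\<rbrakk> \<Longrightarrow> r i (r i x) = x"
  using mul_apply[OF rho(1) rho(1), of i i x] rho_square by simp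

section \<open>Stabilizers of base flags\<close>

lemma rho_generate_closed: "J \<subseteq> typeset \<Gamma> \<Longrightarrow> generate (Aut \<Gamma>) (r ` J) \<subseteq> G"
  using rho(1) by (intro aut.generate_incl) auto

lemma generate_fixes:
  assumes "A \<subseteq> G" "x \<in> E" "\<And>a. a \<in> A \<Longrightarrow> a x = x" "g \<in> generate (Aut \<Gamma>) A"
  shows "g x = x"
  using assms(4)
proof (induction rule: generate.induct)
  case one
  then show ?case using assms(2) by simp
next
  case (incl h)
  then show ?case by (rule assms(3))
next
  case (inv h)
  then show ?case using assms(1,2) assms(3)[of h] inv_apply_eq[of h x x] by blast
next
  case (eng h1 h2)
  then show ?case using mul_apply[of h1 h2 x] assms(2) aut.generate_in_carrier[OF assms(1)] by simp
qed

text \<open>A gallery from \<open>C\<close> to its image whose chambers all contain the base flag of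
  type \<open>J\<close> never changes an element with type in \<open>J\<close>. Its sequence of
  adjacency types spells a word in the generators outside \<open>J\<close> with the same effect on
  \<open>C\<close> as \<open>g\<close>, hence equal to \<open>g\<close>.\<close>

lemma flag_stabilizer:
  assumes J: "J \<subseteq> typeset \<Gamma>" and g: "g \<in> G" and fix_g: "\<And>j. j \<in> J \<Longrightarrow> g (c j) = c j"
  shows "g \<in> generate (Aut \<Gamma>) (r ` (typeset \<Gamma> - J))"
proof -
  let ?W = "generate (Aut \<Gamma>) (r ` (typeset \<Gamma> - J))"
  have W: "?W \<subseteq> G" by (rule rho_generate_closed) auto
  have "c ` J \<subseteq> g ` C"
  proof
    fix x assume "x \<in> c ` J"
    then obtain j where "j \<in> J" "x = g (c j)" using fix_g by auto
    then show "x \<in> g ` C" using c_C J by blast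
  qed
  moreover have "c ` J \<subseteq> C" using c_C J by blast
  ultimately have "(gallery_step (c ` J))\<^sup>*\<^sup>* C (g ` C)"
    using gallery_connected[OF flag_c[OF J] chamber_C chamber_image[OF g chamber_C]] by blast
  then have "\<exists>w\<in>?W. w ` C = g ` C"
  proof (induction rule: rtranclp_induct)
    case base
    have "\<one>\<^bsub>Aut \<Gamma>\<^esub> ` C = C" using chamber_elems[OF chamber_C] by (auto simp: image_iff)
    then show ?case using generate.one by blast
  next
    case (step A B)
    then obtain w where w: "w \<in> ?W" "w ` C = A" by blast
    obtain i where i: "i_adjacent \<Gamma> i A B" "c ` J \<subseteq> A" "c ` J \<subseteq> B"
      using step.hyps unfolding gallery_step_def by blast
    have it: "i \<in> typeset \<Gamma>" using i_adjacent_type i by blast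
    have A: "chamber \<Gamma> A" and B: "chamber \<Gamma> B" using i by (auto simp: i_adjacent_def)
    have "i \<notin> J"
    proof
      assume "i \<in> J"
      then have ci: "c i \<in> A" "c i \<in> B" "ty \<Gamma> (c i) = i" using i it by auto
      have "A = B"
        using chamber_minus[OF A ci(1)] chamber_minus[OF B ci(2)] ci(3) i(1)
        unfolding i_adjacent_def by simp
      then show False using i(1) by (simp add: i_adjacent_def)
    qed
    then have ri: "r i \<in> ?W" using it by (intro generate.incl) auto
    have "i_adjacent \<Gamma> i (w ` C) (w ` r i ` C)"
      using i_adjacent_image rho(2)[OF it] w W by blast
    then have "w ` r i ` C = B" using i_adjacent_unique i w by metis
    moreover have "(w \<cdot> r i) ` C = w ` r i ` C"
      using w W ri chamber_elems[OF chamber_C] by (auto simp: image_iff subset_iff)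
    ultimately show ?case using generate.eng[OF w(1) ri] by metis
  qed
  then obtain w where w: "w \<in> ?W" "w ` C = g ` C" by blast
  have "w = g"
  proof (rule aut_eqI[OF _ g])
    show wG: "w \<in> G" using w W by blast
    fix j assume j: "j \<in> typeset \<Gamma>"
    show "w (c j) = g (c j)"
      using chamber_ty_inj[OF chamber_image[OF g chamber_C]] c_C[OF j] j g wG w
      by (metis aut_ty c_E imageI)
  qed
  then show ?thesis using w by simp
qed

end

section \<open>Parity of walks\<close>

text \<open>The Boolean argument is the parity: true for even length.\<close>

definition walk :: "('a, nat) incidence_structure \<Rightarrow> bool \<Rightarrow> 'a \<Rightarrow> 'a \<Rightarrow> bool" where
  "walk \<Delta> s a b \<longleftrightarrow> (\<exists>k. even k = s \<and> (adj \<Delta> ^^ k) a b)"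

definition walk_connected :: "('a, nat) incidence_structure \<Rightarrow> bool" where
  "walk_connected \<Delta> \<longleftrightarrow> (\<forall>a\<in>vertices \<Delta>. \<forall>b\<in>vertices \<Delta>. \<exists>s. walk \<Delta> s a b)"

lemma adj_sym: "adj \<Delta> a b \<Longrightarrow> adj \<Delta> b a"
  unfolding adj_def by blast

lemma even_walk_iff: "even_walk \<Delta> a b \<longleftrightarrow> walk \<Delta> True a b"
  by (simp add: even_walk_def walk_def)

lemma walk_refl: "walk \<Delta> True a a"
  unfolding walk_def by (rule exI[of _ 0]) simp

lemma walk_adj: "adj \<Delta> a b \<Longrightarrow> walk \<Delta> False a b"
  unfolding walk_def by (rule exI[of _ 1]) auto

text \<open>With truth standing for even, equality of Booleans is addition of parities.\<close>

lemma walk_trans: "\<lbrakk>walk \<Delta> s a b; walk \<Delta> t b c\<rbrakk> \<Longrightarrow> walk \<Delta> (s = t) a c"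
  unfolding walk_def using relpowp_trans[of _ "adj \<Delta>"] by (metis even_add)

text \<open>Each edge added at the far end negates the parity; with this rule lengths need not be
  mentioned again.\<close>

lemma walk_induct [consumes 1, case_names refl step]:
  assumes "walk \<Delta> s a b" and "P True a"
    and "\<And>s b c. \<lbrakk>walk \<Delta> s a b; P s b; adj \<Delta> b c\<rbrakk> \<Longrightarrow> P (\<not> s) c"
  shows "P s b"
proof -
  have "P (even k) b" if "(adj \<Delta> ^^ k) a b" for k
    using that
  proof (induction k arbitrary: b)
    case 0
    then show ?case using assms(2) by simp
  next
    case (Suc k)
    then obtain d where d: "(adj \<Delta> ^^ k) a d" "adj \<Delta> d b" by (auto elim: relpowp_Suc_E)
    then have "walk \<Delta> (even k) a d" unfolding walk_def by blast
    then show ?case using assms(3)[OF _ Suc.IH[OF d(1)] d(2)] by simp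
  qed
  then show ?thesis using assms(1) unfolding walk_def by blast
qed

lemma walk_sym:
  assumes "walk \<Delta> s a b"
  shows "walk \<Delta> s b a"
  using assms
proof (induction rule: walk_induct)
  case refl
  then show ?case by (rule walk_refl)
next
  case (step s b c)
  then show ?case using walk_trans[OF walk_adj[OF adj_sym[OF step.hyps(2)]] step.IH] by simp
qed

lemma walk_vertices: "\<lbrakk>walk \<Delta> s a b; a \<in> vertices \<Delta>\<rbrakk> \<Longrightarrow> b \<in> vertices \<Delta>"
  by (induction rule: walk_induct) (auto simp: adj_def)

lemma walk_map:
  assumes "walk \<Delta> s a b" and "\<And>a b. adj \<Delta> a b \<Longrightarrow> adj \<Delta>' (f a) (f b)"
  shows "walk \<Delta>' s (f a) (f b)"
  using assms(1)
proof (induction rule: walk_induct)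
  case refl
  then show ?case by (rule walk_refl)
next
  case (step s b c)
  then show ?case using walk_trans[OF step.IH walk_adj[OF assms(2)[OF step.hyps(2)]]] by simp
qed

text \<open>Every edge changes the colour, so the parity of a walk is determined by the colours of
  its ends.\<close>

lemma walk_bipartition:
  assumes "bipartition \<Delta> X0 X1" "walk \<Delta> s a b"
  shows "b \<in> X0 \<longleftrightarrow> (a \<in> X0 \<longleftrightarrow> s)"
  using assms(2)
proof (induction rule: walk_induct)
  case refl
  then show ?case by simp
next
  case (step s b c)
  then have "b \<in> X0 \<union> X1" "b \<in> X0 \<longleftrightarrow> c \<in> X1" "c \<in> X0 \<union> X1" "X0 \<inter> X1 = {}"
    using assms(1) unfolding bipartition_def adj_def by blast+
  then show ?case using step by blast
qed

text \<open>Colouring by even reachability from \<open>a\<close> fails on some edge, whose ends are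
  then reached from \<open>a\<close> with equal parity. Closing up through that edge gives an odd
  closed walk at \<open>a\<close>, which corrects the parity of any walk starting there.\<close>

lemma walk_non_bipartite:
  assumes conn: "walk_connected \<Delta>" and nb: "\<not> bipartite \<Delta>"
    and a: "a \<in> vertices \<Delta>" and b: "b \<in> vertices \<Delta>"
  shows "walk \<Delta> s a b"
proof -
  define X where "X = {v \<in> vertices \<Delta>. walk \<Delta> True a v}"
  have "\<not> bipartition \<Delta> X (vertices \<Delta> - X)" using nb unfolding bipartite_def by blast
  then obtain v w where vw: "adj \<Delta> v w" "\<not> (v \<in> X \<longleftrightarrow> w \<in> vertices \<Delta> - X)"
    unfolding bipartition_def X_def by blast
  have V: "v \<in> vertices \<Delta>" "w \<in> vertices \<Delta>" using vw(1) unfolding adj_def by auto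
  have "\<exists>t. walk \<Delta> t a v \<and> walk \<Delta> t a w"
  proof (cases "v \<in> X")
    case True
    then show ?thesis using vw(2) V unfolding X_def by blast
  next
    case False
    then have "\<not> walk \<Delta> True a v" "\<not> walk \<Delta> True a w" using vw(2) V unfolding X_def by auto
    then show ?thesis using conn a V unfolding walk_connected_def by metis
  qed
  then obtain t where t: "walk \<Delta> t a v" "walk \<Delta> t a w" by blast
  then have "walk \<Delta> False a a"
    using walk_trans[OF walk_trans[OF t(1) walk_adj[OF vw(1)]] walk_sym[OF t(2)]] by simp
  moreover obtain s' where "walk \<Delta> s' a b" using conn a b unfolding walk_connected_def by blast
  ultimately show ?thesis using walk_trans[of \<Delta> False a a s' b] by (cases "s' = s") auto
qed

section \<open>Classes of even walks and their opposites\<close>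

lemma parts_eq:
  assumes "P \<in> parts \<Delta>" "a \<in> P"
  shows "P = {b \<in> vertices \<Delta>. walk \<Delta> True a b}"
proof -
  obtain d where d: "P = {b \<in> vertices \<Delta>. walk \<Delta> True d b}"
    using assms(1) unfolding parts_def even_walk_iff by blast
  then have "walk \<Delta> True d a" using assms(2) by blast
  then have "walk \<Delta> True d b \<longleftrightarrow> walk \<Delta> True a b" for b
    using walk_trans[of \<Delta> True] walk_sym by metis
  then show ?thesis using d by simp
qed

lemma part_in_parts: "a \<in> vertices \<Delta> \<Longrightarrow> {b \<in> vertices \<Delta>. walk \<Delta> True a b} \<in> parts \<Delta>"
  unfolding parts_def even_walk_iff by blast

lemma parts_subset: "P \<in> parts \<Delta> \<Longrightarrow> P \<subseteq> vertices \<Delta>"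
  unfolding parts_def by blast

lemma parts_nonempty:
  assumes "P \<in> parts \<Delta>"
  shows "\<exists>a. a \<in> P"
proof -
  obtain a where "a \<in> vertices \<Delta>" "P = {b \<in> vertices \<Delta>. walk \<Delta> True a b}"
    using assms unfolding parts_def even_walk_iff by blast
  then have "a \<in> P" by (simp add: walk_refl)
  then show ?thesis ..
qed

text \<open>This description of the opposite part is the same for bipartite and non-bipartite graphs.\<close>

lemma opposite_part_odd:
  assumes conn: "walk_connected \<Delta>" and P: "P \<in> parts \<Delta>"
  shows "b \<in> opposite_part \<Delta> P \<longleftrightarrow> (\<exists>a\<in>P. walk \<Delta> False a b)"
proof -
  obtain d where d: "d \<in> P" using parts_nonempty[OF P] by blast
  have dV: "d \<in> vertices \<Delta>" using parts_subset[OF P] d by blast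
  note P_eq = parts_eq[OF P d]
  show ?thesis
  proof (cases "bipartite \<Delta>")
    case True
    then obtain X0 X1 where X: "bipartition \<Delta> X0 X1" unfolding bipartite_def by blast
    have "b \<in> vertices \<Delta> - P \<longleftrightarrow> (\<exists>a\<in>P. walk \<Delta> False a b)"
    proof
      assume b: "b \<in> vertices \<Delta> - P"
      then obtain s where s: "walk \<Delta> s d b" using conn dV unfolding walk_connected_def by blast
      then have "\<not> s" using b P_eq by auto
      then show "\<exists>a\<in>P. walk \<Delta> False a b" using s d by auto
    next
      assume "\<exists>a\<in>P. walk \<Delta> False a b"
      then obtain a where a: "a \<in> P" "walk \<Delta> False a b" by blast
      have "\<not> walk \<Delta> True a b"
        using walk_bipartition[OF X] a(2) by blast
      then have "b \<notin> P" using parts_eq[OF P a(1)] by blast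
      then show "b \<in> vertices \<Delta> - P" using walk_vertices[OF a(2)] a(1) parts_subset[OF P] by blast
    qed
    then show ?thesis using True by (simp add: opposite_part_def)
  next
    case False
    have "b \<in> P \<longleftrightarrow> (\<exists>a\<in>P. walk \<Delta> False a b)"
    proof
      assume "b \<in> P"
      then have "walk \<Delta> False d b"
        using walk_non_bipartite[OF conn False dV] parts_subset[OF P] by blast
      then show "\<exists>a\<in>P. walk \<Delta> False a b" using d by blast
    next
      assume "\<exists>a\<in>P. walk \<Delta> False a b"
      then have "b \<in> vertices \<Delta>" using walk_vertices[of \<Delta> False] parts_subset[OF P] by blast
      then show "b \<in> P" using walk_non_bipartite[OF conn False dV] P_eq by blast
    qed
    then show ?thesis using False by (simp add: opposite_part_def)
  qed
qed

lemma bipartition_commute: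
  assumes "bipartition \<Delta> X0 X1"
  shows "bipartition \<Delta> X1 X0"
proof -
  have "a \<in> X1 \<longleftrightarrow> b \<in> X0" if "adj \<Delta> a b" for a b
    using assms adj_sym[OF that] unfolding bipartition_def by blast
  then show ?thesis
    using assms unfolding bipartition_def by (simp add: Un_commute Int_commute)
qed

text \<open>For an automorphism of \<open>\<Gamma>\<close> this is the action to which the coset
  criterion is applied in the non-bipartite case; classes move as sets of vertices.\<close>

fun P_map :: "('a \<Rightarrow> 'b) \<Rightarrow> 'a P_elem \<Rightarrow> 'b P_elem" where
  "P_map f (Vert0 a) = Vert0 (f a)"
| "P_map f (Vert1 a) = Vert1 (f a)"
| "P_map f (Part x P) = Part (f x) (f ` P)"

section \<open>The halving group\<close>

locale halving = based_hypertope \<Gamma> C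
  for \<Gamma> :: "('a, nat) incidence_structure" and C :: "'a set" +
  fixes n :: nat
  assumes rank: "n \<ge> 3" and types: "typeset \<Gamma> = {..<n}" and B1: "B1 \<Gamma>" and B2: "B2 \<Gamma>"
begin

abbreviation "p \<equiv> c 0"
abbreviation "q \<equiv> r 0 (c 0)"
abbreviation "graph F \<equiv> truncation (residue \<Gamma> F) {0, 1}"

text \<open>The whole graph is treated as the residue graph of the empty flag, so that statements
  about residues cover it as the case of an empty \<open>K\<close>.\<close>

lemma graph_empty: "graph {} = truncation \<Gamma> {0, 1}"
  by (simp add: truncation_def residue_def)

lemma type_0 [simp]: "0 \<in> typeset \<Gamma>" and type_1 [simp]: "Suc 0 \<in> typeset \<Gamma>"
  using rank types by auto

lemmas r0_G [simp] = rho(1)[OF type_0]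

lemma edge_other_end:
  assumes "e \<in> E" "ty \<Gamma> e = 1" "a \<in> E" "ty \<Gamma> a = 0" "incident \<Gamma> a e"
    and "b \<in> E" "ty \<Gamma> b = 0" "incident \<Gamma> b e" "b \<noteq> a" 
    and "b' \<in> E" "ty \<Gamma> b' = 0" "incident \<Gamma> b' e" "b' \<noteq> a" 
  shows "b = b'"
proof -
  let ?S = "{v \<in> vertices (truncation \<Gamma> {0, 1}). incident (truncation \<Gamma> {0, 1}) v e}"
  have "e \<in> edges (truncation \<Gamma> {0, 1})" using assms(1,2) by (simp add: edges_def truncation_def)
  then have "card ?S = 2" using B1 unfolding B1_def simple_graph_geometry_def by blast
  then show ?thesis
    by (rule card_2_other[where a = a]) (use assms in \<open>auto simp: vertices_def truncation_def\<close>)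
qed

text \<open>The two ends make up the 0-shadow of \<open>e\<close>, so (B_2) turns their incidence
  with \<open>x\<close> into that of \<open>e\<close>.\<close>

lemma edge_inc:
  assumes "e \<in> E" "ty \<Gamma> e = 1" "a \<in> E" "ty \<Gamma> a = 0" "incident \<Gamma> a e"
    and "b \<in> E" "ty \<Gamma> b = 0" "incident \<Gamma> b e" "b \<noteq> a" 
    and "x \<in> E" "2 \<le> ty \<Gamma> x" "incident \<Gamma> a x" "incident \<Gamma> b x"
  shows "incident \<Gamma> e x"
proof -
  have "shadow0 \<Gamma> e \<subseteq> shadow0 \<Gamma> x"
  proof
    fix v assume "v \<in> shadow0 \<Gamma> e"
    then have v: "v \<in> E" "ty \<Gamma> v = 0" "incident \<Gamma> v e" by (auto simp: shadow0_def)
    then have "v = a \<or> v = b" using edge_other_end[OF assms(1-9), of v] by blast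
    then show "v \<in> shadow0 \<Gamma> x" using v assms by (auto simp: shadow0_def)
  qed
  moreover have "ty \<Gamma> x \<notin> {0, 1}" using assms(11) by auto
  ultimately show ?thesis using B2 assms(1,2,10) unfolding B2_def by blast
qed

section \<open>Graphs of residues\<close>

text \<open>These are the flags whose residue retains both types 0 and 1 and therefore has a
  graph.\<close>

definition upper :: "'a set \<Rightarrow> bool" where
  "upper F \<longleftrightarrow> flag \<Gamma> F \<and> (\<forall>x\<in>F. 2 \<le> ty \<Gamma> x)"

lemma upper_E: "\<lbrakk>upper F; x \<in> F\<rbrakk> \<Longrightarrow> x \<in> E"
  unfolding upper_def flag_def by blast

lemma upper_empty: "upper {}"
  by (simp add: upper_def flag_empty)

lemma upper_single: "\<lbrakk>x \<in> E; 2 \<le> ty \<Gamma> x\<rbrakk> \<Longrightarrow> upper {x}"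
  by (simp add: upper_def flag_def inc_refl)

lemma upper_image: "\<lbrakk>g \<in> G; upper F\<rbrakk> \<Longrightarrow> upper (g ` F)"
  using flag_image upper_E unfolding upper_def by auto

lemma upper_c: "K \<subseteq> {2..<n} \<Longrightarrow> upper (c ` K)"
  using flag_c[of K] types ty_c unfolding upper_def by (auto simp: subset_iff)

lemma vertices_graph:
  assumes "upper F"
  shows "vertices (graph F) = {a \<in> E. ty \<Gamma> a = 0 \<and> (\<forall>x\<in>F. incident \<Gamma> a x)}"
  using assms unfolding vertices_def truncation_def residue_def upper_def by fastforce

lemma adj_E:
  assumes "adj (graph {}) a b"
  shows "a \<in> E" "b \<in> E" "ty \<Gamma> a = 0" "ty \<Gamma> b = 0" "a \<noteq> b"
  using assms unfolding adj_def vertices_graph[OF upper_empty] by auto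

text \<open>By \<open>edge_inc\<close>, an edge with both ends in the residue of \<open>F\<close>
  lies in that residue. Residue graphs are thus induced subgraphs, and walks can be compared across
  residues.\<close>

lemma adj_graph_iff:
  assumes F: "upper F"
  shows "adj (graph F) a b \<longleftrightarrow> adj (graph {}) a b \<and> (\<forall>x\<in>F. incident \<Gamma> a x \<and> incident \<Gamma> b x)"
proof
  assume "adj (graph F) a b"
  then show "adj (graph {}) a b \<and> (\<forall>x\<in>F. incident \<Gamma> a x \<and> incident \<Gamma> b x)"
    unfolding adj_def vertices_graph[OF F] vertices_graph[OF upper_empty]
    by (auto simp: truncation_def residue_def edges_def)
next
  assume R: "adj (graph {}) a b \<and> (\<forall>x\<in>F. incident \<Gamma> a x \<and> incident \<Gamma> b x)"
  note ab = adj_E[OF conjunct1[OF R]]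
  obtain e where e: "e \<in> E" "ty \<Gamma> e = 1" "incident \<Gamma> a e" "incident \<Gamma> b e"
    using R unfolding adj_def by (auto simp: truncation_def residue_def edges_def)
  have "incident \<Gamma> e x" if "x \<in> F" for x
    using edge_inc[OF e(1,2) ab(1,3) e(3) ab(2,4) e(4) ab(5)[symmetric]] R that F upper_E
    unfolding upper_def by blast
  moreover have "e \<notin> F" using F e(2) unfolding upper_def by auto
  ultimately have "e \<in> edges (graph F)" using e
    by (simp add: truncation_def residue_def edges_def)
  then show "adj (graph F) a b"
    using R ab e(3,4) unfolding adj_def vertices_graph[OF F]
    by (auto simp: truncation_def residue_def)
qed

lemma aut_adj:
  assumes g: "g \<in> G" and F: "upper F" and ab: "adj (graph F) a b"
  shows "adj (graph (g ` F)) (g a) (g b)"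
proof -
  have R: "adj (graph {}) a b" "\<forall>x\<in>F. incident \<Gamma> a x \<and> incident \<Gamma> b x"
    using ab adj_graph_iff[OF F] by auto
  note abE = adj_E[OF R(1)]
  obtain e where e: "e \<in> E" "ty \<Gamma> e = 1" "incident \<Gamma> a e" "incident \<Gamma> b e"
    using R unfolding adj_def by (auto simp: truncation_def residue_def edges_def)
  have "g e \<in> edges (graph {})" using e(1,2) g by (simp add: edges_def truncation_def residue_def)
  moreover have "g a \<noteq> g b" using aut_inj[OF g] abE by blast
  ultimately have "adj (graph {}) (g a) (g b)"
    unfolding adj_def vertices_graph[OF upper_empty] using abE e g
    by (intro conjI bexI[of _ "g e"]) (auto simp: truncation_def residue_def)
  moreover have "\<forall>x\<in>F. incident \<Gamma> (g a) (g x) \<and> incident \<Gamma> (g b) (g x)"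
    using R(2) abE(1,2) upper_E[OF F] g by simp
  ultimately show ?thesis using adj_graph_iff[OF upper_image[OF g F]] by auto
qed

lemma aut_walk:
  assumes "g \<in> G" "upper F" "walk (graph F) s a b"
  shows "walk (graph (g ` F)) s (g a) (g b)"
  using walk_map[OF assms(3), of "graph (g ` F)" g] aut_adj[OF assms(1,2)] by blast

lemma walk_whole: "\<lbrakk>upper F; walk (graph F) s a b\<rbrakk> \<Longrightarrow> walk (graph {}) s a b"
  using walk_map[of "graph F" s a b "graph {}" "\<lambda>x. x"] adj_graph_iff by blast

lemma q_E [simp]: "q \<in> E" and ty_q [simp]: "ty \<Gamma> q = 0" and q_ne: "q \<noteq> p"
  using rho_moves[OF type_0] by auto

lemma r0_q [simp]: "r 0 q = p"
  by simp

lemma q_inc: "\<lbrakk>j \<in> typeset \<Gamma>; j \<noteq> 0\<rbrakk> \<Longrightarrow> incident \<Gamma> q (c j)"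
  using aut_inc[of "r 0" p "c j"] rho(4)[of 0 j] by simp

lemma adj_pq_upper:
  assumes K: "K \<subseteq> {2..<n}"
  shows "adj (graph (c ` K)) p q"
proof -
  have 1: "incident \<Gamma> q (c (Suc 0))" by (rule q_inc) auto
  have "c (Suc 0) \<in> edges (graph {})" by (simp add: edges_def truncation_def residue_def)
  then have "adj (graph {}) p q"
    unfolding adj_def vertices_graph[OF upper_empty] using 1 q_ne
    by (intro conjI bexI[of _ "c (Suc 0)"]) (auto simp: truncation_def residue_def)
  moreover have "k \<in> typeset \<Gamma>" "k \<noteq> 0" if "k \<in> K" for k using K that types by auto
  ultimately show ?thesis
    using adj_graph_iff[OF upper_c[OF K]] q_inc by auto
qed

text \<open>An ordered pair of adjacent vertices is placed by placing a flag: with the joining edge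
  \<open>e\<close>, the set of \<open>a\<close>, \<open>e\<close> and the members of
  \<open>F\<close> is a flag, and once it is in position \<open>g q\<close> must be the other end of
  \<open>e\<close>.\<close>

lemma adj_transitive:
  assumes F: "upper F" and ab: "adj (graph F) a b"
  shows "\<exists>g\<in>G. g p = a \<and> g q = b \<and> (\<forall>x\<in>F. g (c (ty \<Gamma> x)) = x)"
proof -
  have R: "adj (graph {}) a b" "\<forall>x\<in>F. incident \<Gamma> a x \<and> incident \<Gamma> b x"
    using ab adj_graph_iff[OF F] by auto
  note abE = adj_E[OF R(1)]
  obtain e where e: "e \<in> E" "ty \<Gamma> e = 1" "incident \<Gamma> a e" "incident \<Gamma> b e"
    using R unfolding adj_def by (auto simp: truncation_def residue_def edges_def)
  have "incident \<Gamma> e x" if "x \<in> F" for x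
    using edge_inc[OF e(1,2) abE(1,3) e(3) abE(2,4) e(4) abE(5)[symmetric]] R that F upper_E
    unfolding upper_def by blast
  then have "flag \<Gamma> (insert a (insert e F))"
    using F R(2) e abE unfolding upper_def by (intro flag_insert) auto
  then obtain g where g: "g \<in> G" "g p = a" "g (c 1) = e" "\<forall>x\<in>F. g (c (ty \<Gamma> x)) = x"
    using flag_trans abE(3) e(2) by (metis insert_iff)
  have "incident \<Gamma> (g q) (g (c 1))" using g(1) q_inc[OF type_1] by simp
  then have "incident \<Gamma> (g q) e" using g(3) by (simp only:)
  moreover have "g q \<noteq> g p" using aut_inj[OF g(1)] q_ne by (metis c_E q_E type_0)
  ultimately have "b = g q"
    using edge_other_end[OF e(1,2) abE(1,3) e(3) abE(2,4) e(4) abE(5)[symmetric], of "g q"] g by simp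
  then show ?thesis using g by blast
qed

text \<open>Since \<open>r i\<close> fixes \<open>p\<close> and the base edge
  \<open>c (Suc 0)\<close>, it fixes the other end of that edge.\<close>

lemma rho_q:
  assumes i: "i \<in> {2..<n}"
  shows "r i q = q"
proof -
  have it: "i \<in> typeset \<Gamma>" "i \<noteq> 0" "i \<noteq> Suc 0" using i types by auto
  note ri = rho(1)[OF it(1)]
  have fx: "r i p = p" "r i (c (Suc 0)) = c (Suc 0)" using rho(4)[OF it(1)] it by auto
  have "incident \<Gamma> (r i q) (r i (c (Suc 0)))" using ri q_inc[OF type_1] by simp
  moreover have "r i q \<noteq> p" using aut_inj[OF ri] q_ne fx(1) by (metis c_E q_E type_0)
  ultimately show ?thesis
    using edge_other_end[of "c (Suc 0)" p "r i q" q] ri q_inc[OF type_1] q_ne fx(2) by simp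
qed

section \<open>Conjugation by the generator of index 0\<close>

text \<open>Written without an inverse because \<open>r 0\<close> is an involution.\<close>

definition conj0 :: "('a \<Rightarrow> 'a) \<Rightarrow> 'a \<Rightarrow> 'a" where
  "conj0 g = r 0 \<cdot> g \<cdot> r 0"

lemma conj0_closed [simp]: "g \<in> G \<Longrightarrow> conj0 g \<in> G"
  by (simp add: conj0_def)

lemma conj0_apply: "\<lbrakk>g \<in> G; x \<in> E\<rbrakk> \<Longrightarrow> conj0 g x = r 0 (g (r 0 x))"
  by (simp add: conj0_def)

lemma conj0_conj0 [simp]: "g \<in> G \<Longrightarrow> conj0 (conj0 g) = g"
  by (rule aut_ext) (simp_all add: conj0_apply)

lemma conj0_one [simp]: "conj0 \<one>\<^bsub>Aut \<Gamma>\<^esub> = \<one>\<^bsub>Aut \<Gamma>\<^esub>"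
  by (simp add: conj0_def rho_square)

lemma conj0_mult: "\<lbrakk>g \<in> G; h \<in> G\<rbrakk> \<Longrightarrow> conj0 (g \<cdot> h) = conj0 g \<cdot> conj0 h"
  by (rule aut_ext) (simp_all add: conj0_apply)

lemma conj0_inv:
  assumes g: "g \<in> G"
  shows "conj0 (inv\<^bsub>Aut \<Gamma>\<^esub> g) = inv\<^bsub>Aut \<Gamma>\<^esub> (conj0 g)"
  using g conj0_mult[of "inv\<^bsub>Aut \<Gamma>\<^esub> g" g] aut.inv_equality[of "conj0 (inv\<^bsub>Aut \<Gamma>\<^esub> g)" "conj0 g"] by simp

text \<open>The conjugate is identified by its effect on base elements. Both factors fix those of
  type other than 0 and \<open>i\<close>; at \<open>p\<close> the conjugate passes through
  \<open>q\<close>, and \<open>rho_q\<close> brings it back.\<close>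

lemma conj0_rho:
  assumes i: "i \<in> {2..<n}"
  shows "conj0 (r i) = r i"
proof (rule rho_unique)
  show it: "i \<in> typeset \<Gamma>" using i types by auto
  note ri = rho(1)[OF it]
  show "conj0 (r i) \<in> G" using ri by simp
  show "conj0 (r i) \<noteq> \<one>\<^bsub>Aut \<Gamma>\<^esub>" using conj0_conj0[OF ri] rho(3)[OF it] by auto
  fix j assume j: "j \<in> typeset \<Gamma>" "j \<noteq> i"
  show "conj0 (r i) (c j) = c j"
  proof (cases "j = 0")
    case True
    then show ?thesis using ri rho_q[OF i] by (simp add: conj0_apply)
  next
    case False
    then show ?thesis
      using j ri rho(4)[OF type_0 j(1)] rho(4)[OF it j] by (simp add: conj0_apply)
  qed
qed

lemma generate_conj0:
  assumes A: "A \<subseteq> G" and B: "B \<subseteq> G" and AB: "\<And>a. a \<in> A \<Longrightarrow> conj0 a \<in> generate (Aut \<Gamma>) B"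
    and g: "g \<in> generate (Aut \<Gamma>) A"
  shows "conj0 g \<in> generate (Aut \<Gamma>) B"
  using g
proof (induction rule: generate.induct)
  case one
  then show ?case by (simp add: generate.one)
next
  case (incl h)
  then show ?case by (rule AB)
next
  case (inv h)
  then show ?case using A AB conj0_inv aut.generate_m_inv_closed[OF B] by (metis subsetD)
next
  case (eng h1 h2)
  then show ?case
    using conj0_mult aut.generate_in_carrier[OF A] generate.eng[of _ "Aut \<Gamma>" B] by metis
qed

section \<open>Halving generators, the subgroups they generate, and parity\<close>

abbreviation "hg \<equiv> halving_gen \<Gamma> C"
text \<open>The argument lists the omitted indices: \<open>H {}\<close> is the halving group,
  \<open>H {i}\<close> its subgroup H(G)_i, and a larger set gives a smaller group.\<close>

abbreviation "H K \<equiv> generate (Aut \<Gamma>) (hg ` ({..<n} - K))"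

lemma hg_0: "hg 0 = conj0 (r (Suc 0))" and hg_pos: "i \<noteq> 0 \<Longrightarrow> hg i = r i"
  by (simp_all add: halving_gen_def conj0_def)

lemma hg_closed: "i < n \<Longrightarrow> hg i \<in> G"
  using rho(1)[of i] rho(1)[OF type_1] types by (cases "i = 0") (simp_all add: hg_0 hg_pos)

lemma hg_sub: "hg ` ({..<n} - K) \<subseteq> G"
  using hg_closed by auto

lemma H_closed: "g \<in> H K \<Longrightarrow> g \<in> G"
  by (rule aut.generate_in_carrier[OF hg_sub])

lemma H_subgroup: "subgroup (H K) (Aut \<Gamma>)"
  by (rule aut.generate_is_subgroup[OF hg_sub])

lemma H_mono: "K \<subseteq> K' \<Longrightarrow> H K' \<subseteq> H K"
  by (rule aut.mono_generate) auto

lemma conj0_hg: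
  assumes "i < n"
  shows "conj0 (hg i) = hg (if i = 0 then 1 else if i = 1 then 0 else i)"
  using assms rho(1)[OF type_1] conj0_rho[of i] by (auto simp: hg_0 hg_pos)

text \<open>Conjugation interchanges the generators of index 0 and 1, both present because
  \<open>K\<close> avoids these types, and fixes all the others.\<close>

lemma H_conj0:
  assumes K: "K \<subseteq> {2..<n}" and g: "g \<in> H K"
  shows "conj0 g \<in> H K"
proof (rule generate_conj0[OF hg_sub hg_sub _ g])
  fix a assume "a \<in> hg ` ({..<n} - K)"
  then obtain i where i: "i < n" "i \<notin> K" "a = hg i" by auto
  let ?j = "if i = 0 then 1 else if i = 1 then 0 else i"
  have "?j \<in> {..<n} - K" using i K rank by auto
  then show "conj0 a \<in> H K"
    unfolding i(3) conj0_hg[OF i(1)] by (intro generate.incl imageI)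
qed

lemma rho_generate_H:
  assumes "0 \<in> K"
  shows "generate (Aut \<Gamma>) (r ` ({..<n} - K)) = H K"
proof -
  have "r ` ({..<n} - K) = hg ` ({..<n} - K)"
    using assms by (intro image_cong refl) (metis DiffD2 hg_pos)
  then show ?thesis by simp
qed

text \<open>An automorphism that also fixes \<open>p\<close> is a word in the \<open>r i\<close>
  with \<open>i\<close> neither 0 nor in \<open>K\<close>, and these are halving generators.\<close>

lemma stabilizer_in_H:
  assumes K: "K \<subseteq> {2..<n}" and g: "g \<in> G" "g p = p" "\<And>k. k \<in> K \<Longrightarrow> g (c k) = c k"
  shows "g \<in> H K"
proof -
  have "g \<in> generate (Aut \<Gamma>) (r ` (typeset \<Gamma> - insert 0 K))"
    by (rule flag_stabilizer) (use K g types type_0 in auto)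
  then have "g \<in> H (insert 0 K)" using rho_generate_H[of "insert 0 K"] types by simp
  then show ?thesis using H_mono[of K "insert 0 K"] by blast
qed

lemma H_fixes:
  assumes K: "K \<subseteq> {2..<n}" and k: "k \<in> K" and g: "g \<in> H K"
  shows "g (c k) = c k"
proof (rule generate_fixes[OF hg_sub _ _ g])
  have kt: "k \<in> typeset \<Gamma>" "k \<noteq> 0" "k \<noteq> Suc 0" using K k types by auto
  show "c k \<in> E" using kt by simp
  fix a assume "a \<in> hg ` ({..<n} - K)"
  then obtain i where i: "i \<in> typeset \<Gamma>" "i \<noteq> k" "a = hg i" using k types by auto
  have 1: "r i' (c k) = c k" if "i' \<in> typeset \<Gamma>" "i' \<noteq> k" for i'
    using rho(4)[OF that(1) kt(1)] that(2) by auto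
  show "a (c k) = c k"
  proof (cases "i = 0")
    case True
    then show ?thesis
      using i kt 1[of 0] 1[of "Suc 0"] rho(1)[OF type_1] by (simp add: hg_0 conj0_apply)
  next
    case False
    then show ?thesis using i 1 by (simp add: hg_pos)
  qed
qed

lemma fix_image: "(\<And>k. k \<in> K \<Longrightarrow> g (c k) = c k) \<Longrightarrow> g ` c ` K = c ` K"
  by (auto simp: image_iff)

text \<open>\<open>S\<close> is a set of admissible parities, closed under concatenation of walks.\<close>

lemma generate_walk:
  assumes K: "K \<subseteq> {2..<n}" and A: "A \<subseteq> G" and S: "True \<in> S" "\<And>s t. \<lbrakk>s \<in> S; t \<in> S\<rbrakk> \<Longrightarrow> (s = t) \<in> S"
    and Afix: "\<And>a k. \<lbrakk>a \<in> A; k \<in> K\<rbrakk> \<Longrightarrow> a (c k) = c k"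
    and Awalk: "\<And>a. a \<in> A \<Longrightarrow> \<exists>s\<in>S. walk (graph (c ` K)) s p (a p)"
    and g: "g \<in> generate (Aut \<Gamma>) A"
  shows "\<exists>s\<in>S. walk (graph (c ` K)) s p (g p)"
proof -
  have cE: "c k \<in> E" if "k \<in> K" for k using K that types by auto
  have gfix: "h (c k) = c k" if "h \<in> generate (Aut \<Gamma>) A" "k \<in> K" for h k
    by (rule generate_fixes[OF A cE[OF that(2)] _ that(1)], rule Afix[OF _ that(2)])
  \<comment> \<open>The generated group fixes the base flag of type \<open>K\<close>, so it permutes
    the walks of the residue graph of that flag.\<close>
  have map: "walk (graph (c ` K)) s (h a) (h b)"
    if "h \<in> generate (Aut \<Gamma>) A" "walk (graph (c ` K)) s a b" for h s a b
    using aut_walk[OF aut.generate_in_carrier[OF A that(1)] upper_c[OF K] that(2)]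
      fix_image[of K h] gfix[OF that(1)] by simp
  show ?thesis
    using g
  proof (induction rule: generate.induct)
    case one
    have "walk (graph (c ` K)) True p (\<one>\<^bsub>Aut \<Gamma>\<^esub> p)" using walk_refl by simp
    then show ?case using S(1) by blast
  next
    case (incl h)
    then show ?case by (rule Awalk)
  next
    case (inv h)
    then obtain s where s: "s \<in> S" "walk (graph (c ` K)) s p (h p)" using Awalk by blast
    have "(inv\<^bsub>Aut \<Gamma>\<^esub> h) (h p) = p" using inv A by auto
    then have "walk (graph (c ` K)) s ((inv\<^bsub>Aut \<Gamma>\<^esub> h) p) p"
      using map[OF generate.inv[OF inv] s(2)] by simp
    then have "walk (graph (c ` K)) s p ((inv\<^bsub>Aut \<Gamma>\<^esub> h) p)" by (rule walk_sym)
    then show ?case using s(1) by blast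
  next
    case (eng h1 h2)
    then obtain s t where st: "s \<in> S" "walk (graph (c ` K)) s p (h1 p)"
      "t \<in> S" "walk (graph (c ` K)) t p (h2 p)" by blast
    \<comment> \<open>The walk to \<open>h1 p\<close> is continued by the image under
      \<open>h1\<close> of the walk from \<open>p\<close> to \<open>h2 p\<close>.\<close>
    have "walk (graph (c ` K)) (s = t) p (h1 (h2 p))"
      using walk_trans[OF st(2) map[OF eng(1) st(4)]] .
    then show ?case using S(2)[OF st(1,3)] aut.generate_in_carrier[OF A] eng(1,2) by auto
  qed
qed

text \<open>Only the generator of index 0 can move \<open>p\<close>, to \<open>r 0 (r 1 q)\<close>.
  The edge from \<open>p\<close> to \<open>q\<close> goes under \<open>r 1\<close> to one from
  \<open>p\<close> to \<open>r 1 q\<close>, and this under \<open>r 0\<close> to one from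
  \<open>q\<close> to \<open>r 0 (r 1 q)\<close>; together they form a walk of length two.\<close>

lemma H_even_walk:
  assumes K: "K \<subseteq> {2..<n}" and g: "g \<in> H K"
  shows "walk (graph (c ` K)) True p (g p)"
proof -
  have step: "walk (graph (c ` K)) s (r i a) (r i b)"
    if "walk (graph (c ` K)) s a b" "i < n" "i \<notin> K" for i s a b
  proof -
    have it: "i \<in> typeset \<Gamma>" using that types by auto
    have "r i (c k) = c k" if "k \<in> K" for k
    proof -
      have "k \<in> typeset \<Gamma>" "k \<noteq> i" using that K types \<open>i \<notin> K\<close> by auto
      then show ?thesis by (rule rho(4)[OF it])
    qed
    then show ?thesis
      using aut_walk[OF rho(1)[OF it] upper_c[OF K] that(1)] fix_image[of K "r i"] by simp
  qed
  have "walk (graph (c ` K)) True p (hg i p)" if i: "i < n" "i \<notin> K" for i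
  proof (cases "i = 0")
    case True
    have 01: "0 < n" "Suc 0 < n" "0 \<notin> K" "Suc 0 \<notin> K" using K rank by auto
    have pq: "walk (graph (c ` K)) False p q" using walk_adj[OF adj_pq_upper[OF K]] .
    have "r (Suc 0) p = p" using rho(4)[OF type_1 type_0] by simp
    then have "walk (graph (c ` K)) False p (r (Suc 0) q)" using step[OF pq 01(2,4)] by simp
    then have "walk (graph (c ` K)) False q (r 0 (r (Suc 0) q))" using step[OF _ 01(1,3)] by blast
    then have "walk (graph (c ` K)) True p (r 0 (r (Suc 0) q))" using walk_trans[OF pq] by fastforce
    then show ?thesis using True rho(1)[OF type_1] by (simp add: hg_0 conj0_apply)
  next
    case False
    then show ?thesis using rho(4)[of i 0] i types walk_refl by (auto simp: hg_pos)
  qed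
  then have "\<exists>s\<in>{True}. walk (graph (c ` K)) s p (a p)" if "a \<in> hg ` ({..<n} - K)" for a
    using that by blast
  moreover have "a (c k) = c k" if "a \<in> hg ` ({..<n} - K)" "k \<in> K" for a k
    using H_fixes[OF K that(2) generate.incl[OF that(1)]] .
  ultimately have "\<exists>s\<in>{True}. walk (graph (c ` K)) s p (g p)"
    by (intro generate_walk[OF K hg_sub _ _ _ _ g]) auto
  then show ?thesis by simp
qed

text \<open>At each step a member of \<open>H K\<close> moves the current vertex back to
  \<open>p\<close> or \<open>q\<close>. A neighbour of \<open>p\<close> is the image of
  \<open>q\<close> under an automorphism fixing \<open>p\<close> and the base flag, hence under a
  member of \<open>H K\<close>; neighbours of \<open>q\<close> reduce to these by conjugation with
  \<open>r 0\<close>.\<close>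

lemma walk_from_p:
  assumes K: "K \<subseteq> {2..<n}" and w: "walk (graph (c ` K)) s p v"
  shows "\<exists>h\<in>H K. v = h (if s then p else q)"
  using w
proof (induction rule: walk_induct)
  case refl
  have "p = \<one>\<^bsub>Aut \<Gamma>\<^esub> p" by simp
  then show ?case using generate.one[of "Aut \<Gamma>" "hg ` ({..<n} - K)"] by (metis (full_types))
next
  case (step s v w)
  have nbr_p: "\<exists>h\<in>H K. w = h q" if adj: "adj (graph (c ` K)) p w" for w
  proof -
    obtain g where g: "g \<in> G" "g p = p" "g q = w" "\<forall>x\<in>c ` K. g (c (ty \<Gamma> x)) = x"
      using adj_transitive[OF upper_c[OF K] adj] by blast
    have "g (c k) = c k" if "k \<in> K" for k
      using g(4) that K types by (metis ty_c atLeastLessThan_iff imageI lessThan_iff subsetD)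
    then have "g \<in> H K" using stabilizer_in_H[OF K g(1,2)] by blast
    then show ?thesis using g by blast
  qed
  have r0K: "r 0 ` c ` K = c ` K"
    using rho(4)[OF type_0] K types by (intro fix_image) auto
  have nbr_q: "\<exists>h\<in>H K. w = h p" if adj: "adj (graph (c ` K)) q w" for w
  proof -
    have "adj (graph (c ` K)) p (r 0 w)"
      using aut_adj[OF r0_G upper_c[OF K] adj] r0K by simp
    then obtain h where h: "h \<in> H K" "r 0 w = h q" using nbr_p by blast
    have "w \<in> E" using adj adj_graph_iff[OF upper_c[OF K]] adj_E by blast
    then have "w = r 0 (h q)" using h(2) rho_rho[OF type_0] by metis
    then have "w = conj0 h p" using H_closed[OF h(1)] by (simp add: conj0_apply)
    then show ?thesis using H_conj0[OF K h(1)] by blast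
  qed
  obtain h where h: "h \<in> H K" "v = h (if s then p else q)" using step by blast
  let ?h' = "inv\<^bsub>Aut \<Gamma>\<^esub> h"
  have h'H: "?h' \<in> H K" using subgroup.m_inv_closed[OF H_subgroup h(1)] .
  have hG: "h \<in> G" "?h' \<in> G" using H_closed h(1) h'H by auto
  have wE: "w \<in> E" using step.hyps(2) adj_graph_iff[OF upper_c[OF K]] adj_E by blast
  have "?h' ` c ` K = c ` K" using fix_image H_fixes[OF K _ h'H] by blast
  then have "adj (graph (c ` K)) (?h' v) (?h' w)"
    using aut_adj[OF hG(2) upper_c[OF K] step.hyps(2)] by simp
  moreover have "?h' v = (if s then p else q)" using h(2) hG by simp
  ultimately obtain k where k: "k \<in> H K" "?h' w = k (if \<not> s then p else q)"
    using nbr_p nbr_q by (cases s) auto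
  have "w = h (?h' w)" using hG wE by simp
  then have "w = (h \<cdot> k) (if \<not> s then p else q)" using k hG H_closed by simp
  then show ?case using generate.eng[OF h(1) k(1)] by blast
qed

text \<open>Some \<open>h\<close> in \<open>H K\<close> agrees with \<open>g\<close> at
  \<open>p\<close>, and the quotient fixes \<open>p\<close> and the base flag. With
  \<open>H_even_walk\<close> this is the parity test for membership in \<open>H K\<close>.\<close>

lemma even_walk_in_H:
  assumes K: "K \<subseteq> {2..<n}" and g: "g \<in> G" "\<And>k. k \<in> K \<Longrightarrow> g (c k) = c k"
    and w: "walk (graph (c ` K)) True p (g p)"
  shows "g \<in> H K"
proof -
  obtain h where h: "h \<in> H K" "g p = h p" using walk_from_p[OF K w] by auto
  let ?h' = "inv\<^bsub>Aut \<Gamma>\<^esub> h"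
  have hG: "h \<in> G" "?h' \<in> G" using H_closed h(1) by auto
  have "?h' \<cdot> g \<in> H K"
  proof (rule stabilizer_in_H[OF K])
    show "?h' \<cdot> g \<in> G" using hG g by simp
    show "(?h' \<cdot> g) p = p" using hG g h(2) by simp
    fix k assume k: "k \<in> K"
    then have "c k \<in> E" using K types by auto
    then show "(?h' \<cdot> g) (c k) = c k"
      using hG g k inv_apply_eq[OF hG(1) _ H_fixes[OF K k h(1)]] by simp
  qed
  moreover have "h \<cdot> (?h' \<cdot> g) = g" using hG g by (simp add: aut.m_assoc[symmetric])
  ultimately show ?thesis using generate.eng[OF h(1)] by metis
qed

text \<open>Connectedness is obtained from the group: flag transitivity takes \<open>p\<close> to
  \<open>a\<close> by \<open>g\<close> and to \<open>b\<close> by \<open>h\<close>, and the quotient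
  is a word in generators fixing the base flag. Each of these fixes \<open>p\<close> or moves it
  along the base edge, so a walk from \<open>p\<close> exists, which \<open>g\<close> carries to one
  from \<open>a\<close> to \<open>b\<close>.\<close>

lemma graph_connected:
  assumes F: "upper F"
  shows "walk_connected (graph F)"
  unfolding walk_connected_def
proof (intro ballI)
  fix a b assume a: "a \<in> vertices (graph F)" and b: "b \<in> vertices (graph F)"
  define K where "K = ty \<Gamma> ` F"
  have K: "K \<subseteq> {2..<n}"
    using F upper_E[OF F] ty_in types unfolding K_def upper_def by force
  have *: "\<exists>g\<in>G. g p = v \<and> (\<forall>x\<in>F. g (c (ty \<Gamma> x)) = x)" if v: "v \<in> vertices (graph F)" for v
  proof -
    have "flag \<Gamma> (insert v F)" "ty \<Gamma> v = 0"
      using F v flag_insert vertices_graph[OF F] unfolding upper_def by auto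
    then show ?thesis using flag_trans by (metis insert_iff)
  qed
  obtain g where g: "g \<in> G" "g p = a" "\<forall>x\<in>F. g (c (ty \<Gamma> x)) = x" using *[OF a] by blast
  obtain h where h: "h \<in> G" "h p = b" "\<forall>x\<in>F. h (c (ty \<Gamma> x)) = x" using *[OF b] by blast
  let ?k = "inv\<^bsub>Aut \<Gamma>\<^esub> g \<cdot> h"
  have kfix: "?k (c k) = c k" if "k \<in> K" for k
  proof -
    have "g (c k) = h (c k)" "c k \<in> E" using g(3) h(3) that K types unfolding K_def by auto
    then show ?thesis using g(1) h(1) by (simp add: inv_apply_eq)
  qed
  have "?k \<in> generate (Aut \<Gamma>) (r ` (typeset \<Gamma> - K))"
    by (rule flag_stabilizer) (use K types g h kfix in auto)
  then have "\<exists>s\<in>UNIV. walk (graph (c ` K)) s p (?k p)"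
  proof (rule generate_walk[OF K, rotated -1])
    show "r ` (typeset \<Gamma> - K) \<subseteq> G" using rho(1) by auto
    show "a (c k) = c k" if a: "a \<in> r ` (typeset \<Gamma> - K)" and k: "k \<in> K" for a k
    proof -
      obtain i where i: "i \<in> typeset \<Gamma>" "i \<notin> K" "a = r i" using a by blast
      have "k \<in> typeset \<Gamma>" "k \<noteq> i" using k i K types by auto
      then show ?thesis unfolding i(3) by (rule rho(4)[OF i(1)])
    qed
    fix a assume "a \<in> r ` (typeset \<Gamma> - K)"
    then obtain i where i: "i \<in> typeset \<Gamma>" "a = r i" by blast
    show "\<exists>s\<in>UNIV. walk (graph (c ` K)) s p (a p)"
    proof (cases "i = 0")
      case True
      then show ?thesis using i walk_adj[OF adj_pq_upper[OF K]] by blast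
    next
      case False
      then have "walk (graph (c ` K)) True p (a p)"
        using i rho(4)[OF i(1) type_0] walk_refl by simp
      then show ?thesis by blast
    qed
  qed auto
  then obtain s where "walk (graph (c ` K)) s p (?k p)" by blast
  then have "walk (graph (g ` c ` K)) s (g p) (g (?k p))"
    using aut_walk[OF g(1) upper_c[OF K]] by blast
  moreover have "g ` c ` K = F" using g(3) unfolding K_def by (auto simp: image_iff)
  moreover have "g (?k p) = b"
    using g(1) h(1,2) inv_apply(2)[of g b] b vertices_graph[OF F] by simp
  ultimately show "\<exists>s. walk (graph F) s a b" using g(2) by auto
qed


section \<open>Stabilizers of the two ends of the base edge\<close>

lemma H_point_stabilizer:
  assumes g: "g \<in> G"
  shows "g \<in> H {0} \<longleftrightarrow> g p = p"
proof
  assume g0: "g \<in> H {0}"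
  show "g p = p"
  proof (rule generate_fixes[OF hg_sub _ _ g0])
    fix a assume "a \<in> hg ` ({..<n} - {0})"
    then obtain i where i: "i \<in> typeset \<Gamma>" "i \<noteq> 0" "a = r i" using types hg_pos by auto
    then show "a p = p" using rho(4)[OF i(1) type_0] by simp
  qed simp
next
  assume "g p = p"
  then have "g \<in> generate (Aut \<Gamma>) (r ` (typeset \<Gamma> - {0}))"
    by (intro flag_stabilizer) (use g in auto)
  then show "g \<in> H {0}" using rho_generate_H[of "{0}"] types by simp
qed

lemma conj0_H_points:
  assumes "i \<in> {0, 1}" and g: "g \<in> H {i}"
  shows "conj0 g \<in> H {1 - i}"
proof (rule generate_conj0[OF hg_sub hg_sub _ g])
  fix a assume "a \<in> hg ` ({..<n} - {i})"
  then obtain j where j: "j < n" "j \<noteq> i" "a = hg j" by auto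
  let ?j = "if j = 0 then 1 else if j = 1 then 0 else j"
  have "?j \<in> {..<n} - {1 - i}" using j rank assms(1) by auto
  then show "conj0 a \<in> H {1 - i}"
    unfolding j(3) conj0_hg[OF j(1)] by (intro generate.incl imageI)
qed

text \<open>Conjugation by \<open>r 0\<close> exchanges \<open>H {0}\<close> with
  \<open>H {1}\<close> and \<open>p\<close> with \<open>q\<close>, so the claim is the one for
  \<open>p\<close> transported.\<close>

lemma H_opposite_point_stabilizer:
  assumes g: "g \<in> G"
  shows "g \<in> H {1} \<longleftrightarrow> g q = q"
proof -
  have "g \<in> H {1} \<longleftrightarrow> conj0 g \<in> H {0}"
    using conj0_H_points[of 0 "conj0 g"] conj0_H_points[of 1 g] g by auto
  also have "\<dots> \<longleftrightarrow> r 0 (g q) = p" using H_point_stabilizer[of "conj0 g"] g by (simp add: conj0_apply)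
  also have "\<dots> \<longleftrightarrow> g q = q"
    using rho_rho[OF type_0, of "g q"] g by (metis autE q_E r0_q)
  finally show ?thesis .
qed

lemma halving_subgroup_eq: "halving_subgroup \<Gamma> C i = H {i}"
  by (simp add: halving_subgroup_def types)

lemma carrier_halving_group: "carrier (halving_group \<Gamma> C) = H {}"
  and mult_halving_group: "g \<otimes>\<^bsub>halving_group \<Gamma> C\<^esub> h = g \<cdot> h"
  and one_halving_group: "\<one>\<^bsub>halving_group \<Gamma> C\<^esub> = \<one>\<^bsub>Aut \<Gamma>\<^esub>"
  by (simp_all add: halving_group_def types)

lemma group_halving_group: "group (halving_group \<Gamma> C)"
  using aut.subgroup_imp_group[OF H_subgroup[of "{}"]] by (simp add: halving_group_def types)

lemma vertices_whole: "vertices (graph {}) = {a \<in> E. ty \<Gamma> a = 0}"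
  using vertices_graph[OF upper_empty] by simp

lemma adj_pq: "adj (graph {}) p q"
  using adj_pq_upper[of "{}"] by simp

lemma p_vertex: "K \<subseteq> {2..<n} \<Longrightarrow> p \<in> vertices (graph (c ` K))"
  using adj_pq_upper unfolding adj_def by blast

section \<open>The bipartite case\<close>

text \<open>The coset criterion is applied to the halving group acting on elements of
  \<open>\<Gamma>\<close>, with \<open>q\<close> in place of the base edge as the base element of
  type 1.\<close>

lemma coset_BP_isomorphic:
  assumes X: "bipartition (graph {}) X0 X1" and p0: "p \<in> X0"
  shows "isomorphic (coset_geometry (halving_group \<Gamma> C) {..<n} (halving_subgroup \<Gamma> C))
    (BP_geometry \<Gamma> X0 X1)"
proof -
  define \<Delta> where "\<Delta> = BP_geometry \<Gamma> X0 X1"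
  have V: "x \<in> X0 \<or> x \<in> X1 \<longleftrightarrow> x \<in> E \<and> ty \<Gamma> x = 0" and disj: "x \<in> X0 \<Longrightarrow> x \<notin> X1" for x
    using X unfolding bipartition_def vertices_whole by blast+
  have elems: "x \<in> elems \<Delta> \<longleftrightarrow> x \<in> X0 \<or> x \<in> X1 \<or> x \<in> E \<and> 2 \<le> ty \<Gamma> x" for x
    unfolding \<Delta>_def BP_geometry_def by auto
  have elemsE: "x \<in> E" if "x \<in> elems \<Delta>" for x using that V elems by blast
  have adj_cross: "a \<in> X0 \<longleftrightarrow> b \<in> X1" if "adj (graph {}) a b" for a b
    using X that unfolding bipartition_def by blast
  have inc: "incident \<Delta> x y \<longleftrightarrow> (if x \<in> X0 \<and> y \<in> X1 \<or> x \<in> X1 \<and> y \<in> X0 then adj (graph {}) x y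
      else incident \<Gamma> x y)" for x y
    unfolding \<Delta>_def BP_geometry_def graph_empty by simp
  have ty0: "ty \<Delta> x = 0" if "x \<in> X0" for x
    using that unfolding \<Delta>_def BP_geometry_def by simp
  have ty1: "ty \<Delta> x = Suc 0" if "x \<in> X1" for x
    using that disj unfolding \<Delta>_def BP_geometry_def by auto
  have ty2: "ty \<Delta> x = ty \<Gamma> x" if "2 \<le> ty \<Gamma> x" "x \<in> E" for x
    using that V[of x] unfolding \<Delta>_def BP_geometry_def by auto
  have q1: "q \<in> X1" using adj_cross adj_pq p0 by simp
  have conn: "walk_connected (graph {})" by (rule graph_connected[OF upper_empty])
  have pV: "p \<in> vertices (graph {})" using p_vertex[of "{}"] by simp
  \<comment> \<open>A walk from \<open>p\<close> to \<open>a\<close> is carried to a walk of the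
    same parity from \<open>h p\<close> to \<open>h a\<close>, and \<open>h p\<close> is reached
    from \<open>p\<close> by an even walk.\<close>
  have color0: "h a \<in> X0 \<longleftrightarrow> a \<in> X0" if h: "h \<in> H {}" and a: "a \<in> E" "ty \<Gamma> a = 0" for h a
  proof -
    have hG: "h \<in> G" using H_closed h .
    obtain s where s: "walk (graph {}) s p a"
      using conn pV a vertices_whole unfolding walk_connected_def by blast
    have "walk (graph {}) s (h p) (h a)" using aut_walk[OF hG upper_empty s] by simp
    moreover have "walk (graph {}) True p (h p)" using H_even_walk[of "{}" h] h by simp
    ultimately have "walk (graph {}) s p (h a)" using walk_trans by fastforce
    then show ?thesis using walk_bipartition[OF X] s by blast
  qed
  have color1: "h a \<in> X1 \<longleftrightarrow> a \<in> X1" if h: "h \<in> H {}" and a: "a \<in> E" "ty \<Gamma> a = 0" for h a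
    using color0[OF that] V[of a] V[of "h a"] disj a H_closed[OF h] by (metis autE aut_ty)
  \<comment> \<open>Connectedness of the residue graph provides some walk from \<open>p\<close> to
    \<open>g p\<close>; it is also a walk of the whole graph, where the equal colours of its ends
    force it to be even.\<close>
  have in_H: "g \<in> H K" if K: "K \<subseteq> {2..<n}" and g: "g \<in> G" "\<And>k. k \<in> K \<Longrightarrow> g (c k) = c k" "g p \<in> X0"
    for K g
  proof -
    have "p \<in> vertices (graph (c ` K))" using p_vertex[OF K] .
    moreover have "incident \<Gamma> (g p) x" if "x \<in> c ` K" for x
    proof -
      obtain k where k: "k \<in> K" "x = c k" "k \<in> typeset \<Gamma>" using \<open>x \<in> c ` K\<close> K types by auto
      have "incident \<Gamma> (g p) (g (c k))" using g(1) k(3) by simp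
      then show ?thesis using g(2)[OF k(1)] k(2) by (simp only:)
    qed
    then have "g p \<in> vertices (graph (c ` K))" using vertices_graph[OF upper_c[OF K]] g(1) by simp
    ultimately obtain s where s: "walk (graph (c ` K)) s p (g p)"
      using graph_connected[OF upper_c[OF K]] unfolding walk_connected_def by blast
    then have "s" using walk_bipartition[OF X walk_whole[OF upper_c[OF K] s]] p0 g(3) by blast
    then show ?thesis using even_walk_in_H[OF K g(1,2)] s by simp
  qed
  define b where "b i = (if i = 0 then p else if i = 1 then q else c i)" for i :: nat
  have b0: "b 0 = p" and b1: "b (Suc 0) = q" and b2: "\<And>i. 2 \<le> i \<Longrightarrow> b i = c i"
    unfolding b_def by auto
  have r0c: "r 0 (c i) = c i" if "i \<in> typeset \<Gamma>" "2 \<le> i" for i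
    using rho(4)[OF type_0 that(1)] that(2) by simp
  have G_trans: "\<exists>g\<in>G. g (b (ty \<Delta> x)) = x \<and> g (b (ty \<Delta> y)) = y"
    if x: "x \<in> elems \<Delta>" and y: "y \<in> elems \<Delta>" and xy: "incident \<Delta> x y" and le: "ty \<Delta> x \<le> ty \<Delta> y"
    for x y
  proof -
    have fl: "flag \<Gamma> {x, y}" if "incident \<Gamma> x y"
      using that elemsE[OF x] elemsE[OF y] inc_refl inc_sym unfolding flag_def by auto
    consider "x \<in> X0" "y \<in> X0" | "x \<in> X0" "y \<in> X1" | "x \<in> X0" "2 \<le> ty \<Gamma> y"
      | "x \<in> X1" "y \<in> X1" | "x \<in> X1" "2 \<le> ty \<Gamma> y" | "2 \<le> ty \<Gamma> x" "2 \<le> ty \<Gamma> y"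
    proof -
      have "\<not> (2 \<le> ty \<Gamma> x \<and> (y \<in> X0 \<or> y \<in> X1))" "\<not> (x \<in> X1 \<and> y \<in> X0)"
        using le ty0 ty1 ty2 elemsE[OF x] by force+
      then show thesis using that x y unfolding elems by blast
    qed
    then show ?thesis
    proof cases
      case 2
      then have "adj (graph {}) x y" using xy inc by simp
      then obtain g where "g \<in> G" "g p = x" "g q = y" using adj_transitive[OF upper_empty] by blast
      then show ?thesis using 2 b0 b1 ty0 ty1 by auto
    next
      case 1
      then have "incident \<Gamma> x y" using xy inc disj[of x] disj[of y] by (auto split: if_splits)
      then obtain g where "g \<in> G" "g p = x" "g p = y" using flag_trans[OF fl] V 1 by (metis insert_iff)
      then show ?thesis using 1 b0 ty0 by auto
    next
      case 3
      then have "incident \<Gamma> x y" using xy inc V[of y] by (auto split: if_splits)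
      then obtain g where "g \<in> G" "g p = x" "g (c (ty \<Gamma> y)) = y"
        using flag_trans[OF fl] V 3 by (metis insert_iff)
      then show ?thesis using 3 b0 b2 ty0 ty2[OF 3(2) elemsE[OF y]] by auto
    next
      case 4
      then have "incident \<Gamma> x y" using xy inc disj[of x] disj[of y] by (auto split: if_splits)
      then obtain g where g: "g \<in> G" "g p = x" "g p = y"
        using flag_trans[OF fl] V 4 by (metis insert_iff)
      \<comment> \<open>Applying \<open>r 0\<close> first makes the base vertex \<open>q\<close> of
        type 1 land where \<open>g\<close> takes \<open>p\<close>.\<close>
      then have "(g \<cdot> r 0) q = x" "(g \<cdot> r 0) q = y" by auto
      then show ?thesis
        using b1 ty1[OF 4(1)] ty1[OF 4(2)] aut.m_closed[OF g(1) r0_G]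
        by (intro bexI[of _ "g \<cdot> r 0"] conjI) (simp_all only:)
    next
      case 5
      then have "incident \<Gamma> x y" using xy inc V[of y] by (auto split: if_splits)
      then obtain g where g: "g \<in> G" "g p = x" "g (c (ty \<Gamma> y)) = y"
        using flag_trans[OF fl] V 5 by (metis insert_iff)
      have "(g \<cdot> r 0) q = x" "(g \<cdot> r 0) (c (ty \<Gamma> y)) = y"
        using g r0c[OF ty_in[OF elemsE[OF y]] 5(2)] ty_in[OF elemsE[OF y]] by auto
      then show ?thesis
        using b1 b2[OF 5(2)] ty1[OF 5(1)] ty2[OF 5(2) elemsE[OF y]] aut.m_closed[OF g(1) r0_G]
        by (intro bexI[of _ "g \<cdot> r 0"] conjI) (simp_all only:)
    next
      case 6
      then have "incident \<Gamma> x y" using xy inc V[of y] V[of x] by (auto split: if_splits)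
      then obtain g where "g \<in> G" "g (c (ty \<Gamma> x)) = x" "g (c (ty \<Gamma> y)) = y"
        using flag_trans[OF fl] by blast
      then show ?thesis
        using 6 b2 ty2[OF 6(1) elemsE[OF x]] ty2[OF 6(2) elemsE[OF y]] by auto
    qed
  qed
  have inc_comm: "incident \<Delta> y x" if "x \<in> elems \<Delta>" "y \<in> elems \<Delta>" "incident \<Delta> x y" for x y
    using that inc inc_sym elemsE adj_sym by (metis (full_types))
  have H_trans: "\<exists>g\<in>H {}. g (b (ty \<Delta> x)) = x \<and> g (b (ty \<Delta> y)) = y"
    if x: "x \<in> elems \<Delta>" and y: "y \<in> elems \<Delta>" and xy: "incident \<Delta> x y" for x y
  proof -
    obtain g where g: "g \<in> G" "g (b (ty \<Delta> x)) = x" "g (b (ty \<Delta> y)) = y"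
      using G_trans[OF x y xy] G_trans[OF y x inc_comm[OF x y xy]] by (meson nle_le)
    have gq: "g p \<in> X0 \<or> g q \<in> X0"
      using aut_adj[OF g(1) upper_empty adj_pq] adj_cross[of "g p" "g q"] 
        V[of "g p"] V[of "g q"] g(1) by auto
    have gpX: "g p \<in> X0" if "g q \<in> X1"
      using aut_adj[OF g(1) upper_empty adj_pq] adj_cross[of "g p" "g q"] that by simp
    show ?thesis
    proof (cases "g p \<in> X0")
      case True
      then have "g \<in> H {}" using in_H[of "{}" g] g by simp
      then show ?thesis using g by blast
    next
      case False
      \<comment> \<open>If \<open>g\<close> interchanges the colours, neither of the two elements
        can be a vertex. Then \<open>r 0\<close> fixes both base elements, so
        \<open>g \<cdot> r 0\<close> does the same job and preserves the colours.\<close>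
      have up: "2 \<le> ty \<Gamma> z \<and> z \<in> E" if z: "z \<in> elems \<Delta>" "g (b (ty \<Delta> z)) = z" for z
      proof -
        have "z \<notin> X0" using z(2) ty0[of z] b0 False by auto
        moreover have "z \<notin> X1" using z(2) ty1[of z] b1 False gpX by auto
        ultimately show ?thesis using z(1) elems by blast
      qed
      have "(g \<cdot> r 0) p \<in> X0" using gq False g(1) by simp
      then have "g \<cdot> r 0 \<in> H {}" using in_H[of "{}" "g \<cdot> r 0"] g by simp
      moreover have "(g \<cdot> r 0) (b (ty \<Delta> z)) = z" if z: "z \<in> elems \<Delta>" "g (b (ty \<Delta> z)) = z" for z
        using up[OF z] z(2) g(1) r0c[of "ty \<Gamma> z"] ty_in[of z] b2[of "ty \<Gamma> z"] ty2[of z] by simp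
      ultimately show ?thesis using g x y by blast
    qed
  qed
  have actE: "h x \<in> elems \<Delta>" and act_ty: "ty \<Delta> (h x) = ty \<Delta> x"
    if h: "h \<in> H {}" and x: "x \<in> elems \<Delta>" for h x
  proof -
    have hG: "h \<in> G" using H_closed h .
    consider "x \<in> X0" | "x \<in> X1" | "x \<in> E" "2 \<le> ty \<Gamma> x" using x elems by blast
    then have "h x \<in> elems \<Delta> \<and> ty \<Delta> (h x) = ty \<Delta> x"
    proof cases
      case 1
      then have "h x \<in> X0" using color0[OF h, of x] V[of x] by auto
      then show ?thesis using 1 ty0 elems by simp
    next
      case 2
      then have "h x \<in> X1" using color1[OF h, of x] V[of x] by auto
      then show ?thesis using 2 ty1 elems by simp
    next
      case 3
      then show ?thesis using hG ty2[of "h x"] ty2[of x] elems by simp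
    qed
    then show "h x \<in> elems \<Delta>" "ty \<Delta> (h x) = ty \<Delta> x" by auto
  qed
  have act_inc: "incident \<Delta> (h x) (h y)"
    if h: "h \<in> H {}" and x: "x \<in> elems \<Delta>" and y: "y \<in> elems \<Delta>" and xy: "incident \<Delta> x y" for h x y
  proof -
    have hG: "h \<in> G" using H_closed h .
    have "h z \<in> X0 \<longleftrightarrow> z \<in> X0" "h z \<in> X1 \<longleftrightarrow> z \<in> X1" if "z \<in> elems \<Delta>" for z
      using color0[OF h, of z] color1[OF h, of z] V[of z] V[of "h z"] hG elemsE[OF that] by auto
    then show ?thesis
      using xy x y hG elemsE aut_adj[OF hG upper_empty, of x y] unfolding inc by auto
  qed
  have "isomorphic (coset_geometry (halving_group \<Gamma> C) {..<n} (halving_subgroup \<Gamma> C)) \<Delta>"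
  proof (rule coset_geometry_isomorphic[where act = "\<lambda>g x. g x" and b = b
        and Ks = "halving_subgroup \<Gamma> C",
      OF group_halving_group, unfolded carrier_halving_group mult_halving_group one_halving_group])
    show "typeset \<Delta> = {..<n}" by (simp add: \<Delta>_def BP_geometry_def types)
    show "(g \<cdot> h) x = g (h x)" if "g \<in> H {}" "h \<in> H {}" "x \<in> elems \<Delta>" for g h x
      using mul_apply[OF H_closed[OF that(1)] H_closed[OF that(2)] elemsE[OF that(3)]] .
    show "ty \<Delta> x \<in> {..<n}" if x: "x \<in> elems \<Delta>" for x
    proof -
      consider "x \<in> X0" | "x \<in> X1" | "x \<in> E" "2 \<le> ty \<Gamma> x" using x elems by blast
      then show ?thesis
        by cases (use ty0[of x] ty1[of x] ty2[of x] rank ty_in[of x] types in simp_all)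
    qed
    show "incident \<Delta> x x" if "x \<in> elems \<Delta>" for x
      using inc_refl[OF elemsE[OF that]] disj[of x] unfolding inc by auto
    fix i assume i: "i \<in> {..<n}"
    then have it: "i \<in> typeset \<Gamma>" using types by simp
    consider "i = 0" | "i = Suc 0" | "2 \<le> i" by linarith
    then have bi: "b i \<in> elems \<Delta> \<and> ty \<Delta> (b i) = i"
      by cases (use it b0 b1 b2 p0 q1 ty0 ty1 ty2[of "c i"] elems in auto)
    then show "b i \<in> elems \<Delta>" "ty \<Delta> (b i) = i" by auto
    show "halving_subgroup \<Gamma> C i = {g \<in> H {}. g (b i) = b i}"
    proof -
      have sub: "H {i} \<subseteq> H {}" by (rule H_mono) simp
      consider "i = 0" | "i = Suc 0" | "2 \<le> i" by linarith
      then have "g \<in> H {i} \<longleftrightarrow> g (b i) = b i" if g: "g \<in> H {}" for g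
      proof cases
        case 1
        then show ?thesis using H_point_stabilizer[OF H_closed[OF g]] b0 by simp
      next
        case 2
        then show ?thesis using H_opposite_point_stabilizer[OF H_closed[OF g]] b1 by simp
      next
        case 3
        then have K: "{i} \<subseteq> {2..<n}" using i by auto
        have "g p \<in> X0" using color0[OF g, of p] p0 by simp
        then show ?thesis
          using in_H[OF K H_closed[OF g]] H_fixes[OF K, of i g] b2[OF 3] by auto
      qed
      then show ?thesis unfolding halving_subgroup_eq using sub by blast
    qed
  next
    fix i j assume ij: "i \<in> {..<n}" "j \<in> {..<n}"
    have "incident \<Delta> (b i) (b j)" if le: "i \<le> j" and "i \<in> {..<n}" "j \<in> {..<n}" for i j
    proof -
      have it: "i \<in> typeset \<Gamma>" "j \<in> typeset \<Gamma>" using that types by auto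
      have nX: "c k \<notin> X0" "c k \<notin> X1" if "k \<in> typeset \<Gamma>" "2 \<le> k" for k
        using V[of "c k"] that by auto
      consider "i = 0" "j = 0" | "i = 0" "j = Suc 0" | "i = 0" "2 \<le> j" | "i = Suc 0" "j = Suc 0"
        | "i = Suc 0" "2 \<le> j" | "2 \<le> i" "2 \<le> j" using le by linarith
      then show ?thesis
        using p0 q1 disj[of p] disj[of q] b0 b1 b2 nX it adj_pq q_inc[of j] inc_refl[of q]
        unfolding inc by cases auto
    qed
    moreover have "b k \<in> elems \<Delta>" if "k \<in> {..<n}" for k
    proof -
      consider "k = 0" | "k = Suc 0" | "2 \<le> k" by linarith
      then show ?thesis by cases (use that types b0 b1 b2 p0 q1 elems in auto)
    qed
    ultimately show "incident \<Delta> (b i) (b j)"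
      using ij inc_comm by (meson nle_le)
  qed (use H_closed elemsE actE act_ty act_inc H_trans in auto)
  then show ?thesis unfolding \<Delta>_def .
qed

text \<open>Needed because the base vertex may lie in either colour class.\<close>

lemma BP_isomorphic_swap:
  assumes X: "bipartition (graph {}) X0 X1" and p0: "p \<in> X1"
  shows "isomorphic (BP_geometry \<Gamma> X1 X0) (BP_geometry \<Gamma> X0 X1)"
proof -
  have V: "x \<in> X0 \<or> x \<in> X1 \<longleftrightarrow> x \<in> E \<and> ty \<Gamma> x = 0" and disj: "x \<in> X0 \<Longrightarrow> x \<notin> X1" for x
    using X unfolding bipartition_def vertices_whole by blast+
  have q0: "q \<in> X0"
    using X adj_sym[OF adj_pq] p0 unfolding bipartition_def by blast
  have conn: "walk_connected (graph {})" by (rule graph_connected[OF upper_empty])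
  have pV: "p \<in> vertices (graph {})" using p_vertex[of "{}"] by simp
  \<comment> \<open>As \<open>r 0\<close> moves \<open>p\<close> in \<open>X1\<close> to
    \<open>q\<close> in \<open>X0\<close>, it exchanges the classes: walks from \<open>p\<close>
    become walks of the same parity from \<open>q\<close>. Hence \<open>r 0\<close> itself is the
    isomorphism.\<close>
  have swap0: "r 0 a \<in> X0 \<longleftrightarrow> a \<in> X1" if a: "a \<in> E" "ty \<Gamma> a = 0" for a
  proof -
    obtain s where s: "walk (graph {}) s p a"
      using conn pV a vertices_whole unfolding walk_connected_def by blast
    have w: "walk (graph {}) s q (r 0 a)" using aut_walk[OF r0_G upper_empty s] by simp
    show ?thesis
      using walk_bipartition[OF X w] walk_bipartition[OF X s] q0 p0 disj[of p] disj[of a] V[of a] a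
      by blast
  qed
  have swap1: "r 0 a \<in> X1 \<longleftrightarrow> a \<in> X0" if a: "a \<in> E" "ty \<Gamma> a = 0" for a
    using swap0[of "r 0 a"] a by simp
  let ?A = "BP_geometry \<Gamma> X1 X0" and ?B = "BP_geometry \<Gamma> X0 X1"
  have el: "elems ?B = elems ?A" by (auto simp: BP_geometry_def)
  have elA: "x \<in> elems ?A \<longleftrightarrow> x \<in> E \<and> (ty \<Gamma> x = 0 \<or> 2 \<le> ty \<Gamma> x)" for x
    using V[of x] by (auto simp: BP_geometry_def)
  have bij: "bij_betw (r 0) (elems ?A) (elems ?B)"
    unfolding el by (rule bij_betwI[of _ _ _ "r 0"]) (auto simp: elA)
  have sw: "r 0 x \<in> X0 \<longleftrightarrow> x \<in> X1" "r 0 x \<in> X1 \<longleftrightarrow> x \<in> X0" if "x \<in> E" for x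
    using that swap0[of x] swap1[of x] V[of x] V[of "r 0 x"] by auto
  have "ty ?B (r 0 x) = ty ?A x" if "x \<in> elems ?A" for x
    using that sw[of x] disj elA by (auto simp: BP_geometry_def)
  moreover have "incident ?B (r 0 x) (r 0 y) \<longleftrightarrow> incident ?A x y"
    if "x \<in> elems ?A" "y \<in> elems ?A" for x y
  proof -
    have xy: "x \<in> E" "y \<in> E" using that elA by auto
    have "adj (graph {}) (r 0 x) (r 0 y) \<longleftrightarrow> adj (graph {}) x y"
      using aut_adj[OF r0_G upper_empty, of x y] aut_adj[OF r0_G upper_empty, of "r 0 x" "r 0 y"] xy by auto
    then show ?thesis
      using sw[OF xy(1)] sw[OF xy(2)] xy unfolding graph_empty by (simp add: BP_geometry_def)
  qed
  moreover have "typeset ?A = typeset ?B" by (simp add: BP_geometry_def)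
  ultimately show ?thesis
    using bij unfolding isomorphic_def by blast
qed


section \<open>The non-bipartite case\<close>

text \<open>A class is named by any of its vertices, so that moving the class amounts to moving one
  vertex.\<close>

definition part :: "'a \<Rightarrow> 'a \<Rightarrow> 'a set" where
  "part x a = {b \<in> vertices (graph {x}). walk (graph {x}) True a b}"

text \<open>In a connected non-bipartite graph any two vertices are joined by an even walk, so every
  automorphism passes the parity test for the empty flag.\<close>

lemma H_eq_G:
  assumes "\<not> bipartite (graph {})"
  shows "H {} = G"
proof
  show "H {} \<subseteq> G" using H_closed by blast
  show "G \<subseteq> H {}"
  proof
    fix g assume g: "g \<in> G"
    have "p \<in> vertices (graph {})" "g p \<in> vertices (graph {})" using vertices_whole g by auto
    then have "walk (graph {}) True p (g p)"
      using walk_non_bipartite[OF graph_connected[OF upper_empty] assms] by blast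
    then show "g \<in> H {}" using even_walk_in_H[of "{}" g] g by simp
  qed
qed

lemma vertices_single:
  assumes "x \<in> E" "2 \<le> ty \<Gamma> x"
  shows "a \<in> vertices (graph {x}) \<longleftrightarrow> a \<in> E \<and> ty \<Gamma> a = 0 \<and> incident \<Gamma> a x"
  using vertices_graph[OF upper_single[OF assms]] by simp

lemma part_in:
  assumes "a \<in> vertices (graph {x})"
  shows "part x a \<in> parts (graph {x})" "a \<in> part x a"
  using part_in_parts[OF assms] assms walk_refl[of "graph {x}" a] unfolding part_def by simp_all

lemma parts_part: "\<lbrakk>P \<in> parts (graph {x}); a \<in> P\<rbrakk> \<Longrightarrow> P = part x a"
  unfolding part_def by (rule parts_eq)

lemma aut_walk_single:
  assumes "g \<in> G" "x \<in> E" "2 \<le> ty \<Gamma> x" "walk (graph {x}) s a b"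
  shows "walk (graph {g x}) s (g a) (g b)"
  using aut_walk[OF assms(1) upper_single[OF assms(2,3)] assms(4)] by simp

lemma part_image:
  assumes g: "g \<in> G" and x: "x \<in> E" "2 \<le> ty \<Gamma> x" and a: "a \<in> vertices (graph {x})"
  shows "g ` part x a = part (g x) (g a)"
proof
  have gx: "g x \<in> E" "2 \<le> ty \<Gamma> (g x)" using g x by auto
  show "g ` part x a \<subseteq> part (g x) (g a)"
    using aut_walk_single[OF g x] vertices_single[OF x] vertices_single[OF gx] g x(1)
    unfolding part_def by auto
  show "part (g x) (g a) \<subseteq> g ` part x a"
  proof
    fix b assume b: "b \<in> part (g x) (g a)"
    let ?h = "inv\<^bsub>Aut \<Gamma>\<^esub> g"
    have h: "?h \<in> G" using g by simp
    have bV: "b \<in> E" "ty \<Gamma> b = 0" "incident \<Gamma> b (g x)"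
      using b vertices_single[OF gx] unfolding part_def by auto
    have aE: "a \<in> E" using a vertices_single[OF x] by simp
    have hx: "?h (g x) = x" "?h (g a) = a" using g x aE by auto
    have "walk (graph {?h (g x)}) True (?h (g a)) (?h b)"
      using aut_walk_single[OF h gx] b unfolding part_def by blast
    then have "walk (graph {x}) True a (?h b)" unfolding hx .
    moreover have "incident \<Gamma> (?h b) (?h (g x))" using aut_inc[OF h bV(1) gx(1)] bV(3) by (simp only:)
    then have "?h b \<in> vertices (graph {x})"
      using vertices_single[OF x] h bV hx(1) by simp
    ultimately have "?h b \<in> part x a" unfolding part_def by simp
    moreover have "g (?h b) = b" using g bV by simp
    ultimately show "b \<in> g ` part x a" by (metis imageI)
  qed
qed

lemma parts_image:
  assumes g: "g \<in> G" and x: "x \<in> E" "2 \<le> ty \<Gamma> x" and P: "P \<in> parts (graph {x})"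
  shows "g ` P \<in> parts (graph {g x})"
proof -
  obtain a where a: "a \<in> P" using parts_nonempty[OF P] by blast
  have gx: "g x \<in> E" "2 \<le> ty \<Gamma> (g x)" using g x by auto
  have aV: "a \<in> vertices (graph {x})" using parts_subset[OF P] a by blast
  then have gaV: "g a \<in> vertices (graph {g x})"
    using vertices_single[OF x] vertices_single[OF gx] g x(1) by simp
  have "g ` P = part (g x) (g a)" using part_image[OF g x aV] parts_part[OF P a] by simp
  then show ?thesis using part_in(1)[OF gaV] by simp
qed

lemma opposite_part_single:
  assumes "x \<in> E" "2 \<le> ty \<Gamma> x" "P \<in> parts (graph {x})"
  shows "b \<in> opposite_part (graph {x}) P \<longleftrightarrow> (\<exists>a\<in>P. walk (graph {x}) False a b)"
  by (rule opposite_part_odd[OF graph_connected[OF upper_single[OF assms(1,2)]] assms(3)])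

section \<open>The geometry of vertices and classes, with the action of automorphisms\<close>

lemma P_elems_cases [consumes 1, case_names Vert0 Vert1 Part]:
  assumes "z \<in> elems (P_geometry \<Gamma>)"
  obtains a where "z = Vert0 a" "a \<in> E" "ty \<Gamma> a = 0"
  | a where "z = Vert1 a" "a \<in> E" "ty \<Gamma> a = 0"
  | x P where "z = Part x P" "x \<in> E" "2 \<le> ty \<Gamma> x" "P \<in> parts (graph {x})"
  using assms unfolding P_geometry_def by auto

lemma P_elems_iff [simp]:
  "Vert0 a \<in> elems (P_geometry \<Gamma>) \<longleftrightarrow> a \<in> E \<and> ty \<Gamma> a = 0"
  "Vert1 a \<in> elems (P_geometry \<Gamma>) \<longleftrightarrow> a \<in> E \<and> ty \<Gamma> a = 0"
  "Part x P \<in> elems (P_geometry \<Gamma>) \<longleftrightarrow> x \<in> E \<and> 2 \<le> ty \<Gamma> x \<and> P \<in> parts (graph {x})"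
  unfolding P_geometry_def by auto

lemma incident_P [simp]: "incident (P_geometry \<Gamma>) = P_incident \<Gamma>"
  and ty_P [simp]: "ty (P_geometry \<Gamma>) = P_ty \<Gamma>"
  by (simp_all add: P_geometry_def)

lemma P_incident_sym:
  assumes "u \<in> elems (P_geometry \<Gamma>)" "v \<in> elems (P_geometry \<Gamma>)" "P_incident \<Gamma> u v"
  shows "P_incident \<Gamma> v u"
  using assms(1)
proof (cases rule: P_elems_cases)
  case (Part x P)
  show ?thesis using assms(2)
  proof (cases rule: P_elems_cases)
    case (Part y Q)
    then show ?thesis using \<open>u = Part x P\<close> \<open>x \<in> E\<close> assms(3) inc_sym[of x y] by auto
  qed (use Part assms(3) in auto)
next
  case (Vert0 a)
  show ?thesis using assms(2) by (cases rule: P_elems_cases) (use Vert0 assms(3) in auto)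
next
  case (Vert1 a)
  show ?thesis using assms(2) by (cases rule: P_elems_cases) (use Vert1 assms(3) in auto)
qed

lemma aut_adj_whole: "\<lbrakk>g \<in> G; adj (graph {}) a b\<rbrakk> \<Longrightarrow> adj (graph {}) (g a) (g b)"
  using aut_adj[OF _ upper_empty] by simp

lemma P_part_E: "\<lbrakk>x \<in> E; 2 \<le> ty \<Gamma> x; P \<in> parts (graph {x}); a \<in> P\<rbrakk> \<Longrightarrow>
    a \<in> E \<and> ty \<Gamma> a = 0 \<and> incident \<Gamma> a x"
  using parts_subset[of P "graph {x}"] vertices_single[of x a] by blast

text \<open>Ordering the pair by type omits the mirror cases, which \<open>P_incident_sym\<close>
  supplies. For \<open>Vert1\<close> against \<open>Part\<close>, the description of opposite parts
  by odd walks is transported without asking whether the residue graph is bipartite.\<close>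

lemma P_act_inc:
  assumes g: "g \<in> G" and u: "u \<in> elems (P_geometry \<Gamma>)" and v: "v \<in> elems (P_geometry \<Gamma>)"
    and uv: "P_incident \<Gamma> u v" and le: "P_ty \<Gamma> u \<le> P_ty \<Gamma> v"
  shows "P_incident \<Gamma> (P_map g u) (P_map g v)"
  using u
proof (cases rule: P_elems_cases)
  case (Vert0 a)
  note Ua = Vert0
  show ?thesis using v
  proof (cases rule: P_elems_cases)
    case (Vert0 b)
    then show ?thesis using Ua uv by simp
  next
    case (Vert1 b)
    have "adj (graph {}) a b" using Ua Vert1 uv graph_empty by simp
    then show ?thesis using Ua Vert1 aut_adj_whole[OF g] graph_empty by simp
  next
    case (Part y Q)
    then show ?thesis using Ua uv g by auto
  qed
next
  case (Vert1 a)
  note Ua = Vert1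
  show ?thesis using v
  proof (cases rule: P_elems_cases)
    case (Vert0 b)
    then show ?thesis using Ua le by simp
  next
    case (Vert1 b)
    then show ?thesis using Ua uv by simp
  next
    case (Part y Q)
    have y: "y \<in> E" "2 \<le> ty \<Gamma> y" and Q: "Q \<in> parts (graph {y})" using Part by auto
    have gy: "g y \<in> E" "2 \<le> ty \<Gamma> (g y)" using y g by auto
    have "incident \<Gamma> a y" "a \<in> opposite_part (graph {y}) Q" using Ua Part uv by auto
    then obtain d where d: "incident \<Gamma> a y" "d \<in> Q" "walk (graph {y}) False d a"
      using opposite_part_single[OF y Q] by blast
    have "walk (graph {g y}) False (g d) (g a)" using aut_walk_single[OF g y d(3)] .
    then have "g a \<in> opposite_part (graph {g y}) (g ` Q)"
      using opposite_part_single[OF gy parts_image[OF g y Q]] d(2) by blast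
    then show ?thesis using Ua Part(1) d(1) g y by simp
  qed
next
  case (Part x P)
  note Ux = Part
  show ?thesis using v
  proof (cases rule: P_elems_cases)
    case (Part y Q)
    then show ?thesis using Ux uv g by auto
  qed (use Ux le in auto)
qed

lemma c_upper:
  assumes "i \<in> {2..<n}"
  shows "c i \<in> E" "2 \<le> ty \<Gamma> (c i)" "i \<in> typeset \<Gamma>" "p \<in> vertices (graph {c i})"
  using assms types p_vertex[of "{i}"] by auto

lemma adj_pq_single: "i \<in> {2..<n} \<Longrightarrow> adj (graph {c i}) p q"
  using adj_pq_upper[of "{i}"] by simp

text \<open>Since \<open>H {}\<close> is \<open>G\<close> here, transitivity and invariance concern
  arbitrary automorphisms; among the stabilizers, only those of base elements of type >= 2 require
  the parity test.\<close>

lemma coset_P_isomorphic: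
  assumes nb: "\<not> bipartite (graph {})"
  shows "isomorphic (coset_geometry (halving_group \<Gamma> C) {..<n} (halving_subgroup \<Gamma> C)) (P_geometry \<Gamma>)"
proof -
  define b where "b i = (if i = 0 then Vert0 p else if i = 1 then Vert1 q
    else Part (c i) (part (c i) p))" for i :: nat
  have b0: "b 0 = Vert0 p" and b1: "b (Suc 0) = Vert1 q"
    and b2: "\<And>i. 2 \<le> i \<Longrightarrow> b i = Part (c i) (part (c i) p)"
    unfolding b_def by auto
  have tri: "i = 0 \<or> i = Suc 0 \<or> i \<in> {2..<n}" if "i < n" for i using that by auto
  have act_b2: "P_map g (b i) = Part (g (c i)) (part (g (c i)) (g p))"
    if "g \<in> G" "i \<in> {2..<n}" for g i
    using part_image[OF that(1) c_upper(1,2,4)[OF that(2)]] b2 that(2) by simp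
  have up: "ty \<Gamma> y \<in> {2..<n}" if "y \<in> E" "2 \<le> ty \<Gamma> y" for y
    using that ty_in[of y] types by simp
  have flag_pair: "\<exists>g\<in>G. g (c (ty \<Gamma> x)) = x \<and> g (c (ty \<Gamma> y)) = y"
    if "x \<in> E" "y \<in> E" "incident \<Gamma> x y" for x y
  proof -
    have "flag \<Gamma> {x, y}" using that inc_refl inc_sym unfolding flag_def by auto
    then show ?thesis using flag_trans by blast
  qed
  have trans: "\<exists>g\<in>G. P_map g (b (P_ty \<Gamma> u)) = u \<and> P_map g (b (P_ty \<Gamma> v)) = v"
    if u: "u \<in> elems (P_geometry \<Gamma>)" and v: "v \<in> elems (P_geometry \<Gamma>)"
      and uv: "P_incident \<Gamma> u v" and le: "P_ty \<Gamma> u \<le> P_ty \<Gamma> v" for u v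
    using u
  proof (cases rule: P_elems_cases)
    case (Vert0 a)
    note Ua = Vert0
    show ?thesis using v
    proof (cases rule: P_elems_cases)
      case (Vert0 d)
      obtain g where "g \<in> G" "g p = a" using flag_pair[of a a] Ua(2,3) inc_refl by metis
      then show ?thesis using Ua Vert0 uv b0 by (intro bexI[of _ g]) auto
    next
      case (Vert1 d)
      have "adj (graph {}) a d" using Ua Vert1 uv graph_empty by simp
      then obtain g where "g \<in> G" "g p = a" "g q = d" using adj_transitive[OF upper_empty] by blast
      then show ?thesis using Ua Vert1 b0 b1 by (intro bexI[of _ g]) auto
    next
      case (Part y Q)
      have aQ: "incident \<Gamma> a y" "a \<in> Q" using Ua Part(1) uv by auto
      obtain g where g: "g \<in> G" "g p = a" "g (c (ty \<Gamma> y)) = y"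
        using flag_pair[OF Ua(2) Part(2) aQ(1)] Ua(3) by metis
      then show ?thesis
        using Ua Part b0 act_b2[OF g(1) up[OF Part(2,3)]] parts_part[OF Part(4) aQ(2)]
        by (intro bexI[of _ g]) auto
    qed
  next
    case (Vert1 a)
    note Ua = Vert1
    show ?thesis using v
    proof (cases rule: P_elems_cases)
      case (Vert0 d)
      then show ?thesis using Ua le by simp
    next
      case (Vert1 d)
      obtain g where "g \<in> G" "g p = a" using flag_pair[of a a] Ua(2,3) inc_refl by metis
      then show ?thesis using Ua Vert1 uv b1 by (intro bexI[of _ "g \<cdot> r 0"]) auto
    next
      case (Part y Q)
      have "incident \<Gamma> a y" "a \<in> opposite_part (graph {y}) Q" using Ua Part(1) uv by auto
      then obtain d where d: "incident \<Gamma> a y" "d \<in> Q" "walk (graph {y}) False d a"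
        using opposite_part_single[OF Part(2-4)] by blast
      obtain g where g: "g \<in> G" "g p = a" "g (c (ty \<Gamma> y)) = y"
        using flag_pair[OF Ua(2) Part(2) d(1)] Ua(3) by metis
      note i = up[OF Part(2,3)]
      \<comment> \<open>The aim is to send \<open>q\<close> to \<open>a\<close>, so
        \<open>r 0\<close> is applied before \<open>g\<close> and \<open>p\<close> goes to
        \<open>g q\<close>. This vertex is adjacent to \<open>a\<close> in the residue of
        \<open>y\<close>, hence joined to \<open>d\<close> by an even walk and a member of
        \<open>Q\<close>, so the base class goes to \<open>Q\<close>.\<close>
      have w: "walk (graph {y}) False a (g q)"
        using aut_walk_single[OF g(1) c_upper(1,2)[OF i] walk_adj[OF adj_pq_single[OF i]]] g by simp
      have "walk (graph {y}) True d (g q)" using walk_trans[OF d(3) w] by simp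
      then have "g q \<in> Q"
        using parts_eq[OF Part(4) d(2)] walk_vertices[OF w] d(1) Ua(2,3) vertices_single[OF Part(2,3)]
        by auto
      then have Q: "Q = part y (g q)" by (rule parts_part[OF Part(4)])
      have gr: "g \<cdot> r 0 \<in> G" "(g \<cdot> r 0) p = g q" "(g \<cdot> r 0) q = a" "(g \<cdot> r 0) (c (ty \<Gamma> y)) = y"
        using g rho(4)[OF type_0 c_upper(3)[OF i]] i c_upper(1)[OF i] by auto
      have "P_map (g \<cdot> r 0) (b (ty \<Gamma> y)) = Part y Q"
        using act_b2[OF gr(1) i] gr Q by simp
      then show ?thesis
        using Ua Part(1) b1 gr(1,3) by (intro bexI[of _ "g \<cdot> r 0"]) auto
    qed
  next
    case (Part x P)
    note Ux = Part
    show ?thesis using v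
    proof (cases rule: P_elems_cases)
      case (Part y Q)
      \<comment> \<open>A common vertex of the two classes determines both, and it forms a flag with
        \<open>x\<close> and \<open>y\<close>; placing this flag places the classes as well.\<close>
      obtain a where a: "incident \<Gamma> x y" "a \<in> P" "a \<in> Q" using Ux(1) Part(1) uv by auto
      have aE: "a \<in> E" "ty \<Gamma> a = 0" "incident \<Gamma> a x" "incident \<Gamma> a y"
        using P_part_E[OF Ux(2-4) a(2)] P_part_E[OF Part(2-4) a(3)] by auto
      have "flag \<Gamma> {y}" using Part(2) inc_refl by (simp add: flag_def)
      then have "flag \<Gamma> {a, x, y}"
        using flag_insert[OF flag_insert[of "{y}" x], of a] a(1) aE Ux(2) by auto
      then obtain g where g: "g \<in> G" "g p = a" "g (c (ty \<Gamma> x)) = x" "g (c (ty \<Gamma> y)) = y"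
        using flag_trans aE(2) by (metis insert_iff)
      then show ?thesis
        using Ux(1) Part(1) act_b2[OF g(1) up[OF Ux(2,3)]] act_b2[OF g(1) up[OF Part(2,3)]]
          parts_part[OF Ux(4) a(2)] parts_part[OF Part(4) a(3)]
        by (intro bexI[of _ g]) auto
    qed (use Ux le in auto)
  qed
  have bE: "b i \<in> elems (P_geometry \<Gamma>) \<and> P_ty \<Gamma> (b i) = i" if "i < n" for i
    using tri[OF that]
  proof (elim disjE)
    assume i: "i \<in> {2..<n}"
    then show ?thesis using b2 c_upper[OF i] part_in(1)[OF c_upper(4)[OF i]] by auto
  qed (use b0 b1 in auto)
  have b_inc: "P_incident \<Gamma> (b i) (b j)" if ij: "i < n" "j < n" and le: "i \<le> j" for i j
  proof (cases "j \<in> {2..<n}")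
    case True
    note cj = c_upper[OF True]
    note pj = part_in[OF cj(4)]
    have pinc: "incident \<Gamma> p (c j)" using cj by simp
    have "q \<in> opposite_part (graph {c j}) (part (c j) p)"
      using opposite_part_single[OF cj(1,2) pj(1)] pj(2) walk_adj[OF adj_pq_single[OF True]] by blast
    moreover have "incident \<Gamma> q (c j)" using q_inc[OF cj(3)] True by simp
    moreover have "P_incident \<Gamma> (b i) (b j)" if i: "i \<in> {2..<n}"
    proof -
      have "p \<in> part (c i) p \<inter> part (c j) p"
        using pj(2) part_in(2)[OF c_upper(4)[OF i]] by blast
      then show ?thesis using b2 i True c_upper(3)[OF i] cj(3) by auto
    qed
    ultimately show ?thesis using tri[OF ij(1)] b0 b1 b2[of j] True pj(2) pinc by auto
  next
    case False
    then have "(i = 0 \<or> i = Suc 0) \<and> (j = 0 \<or> j = Suc 0)" using ij le by auto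
    then show ?thesis using le b0 b1 adj_pq graph_empty by auto
  qed
  have act_ty: "P_ty \<Gamma> (P_map g u) = P_ty \<Gamma> u"
    and actE: "P_map g u \<in> elems (P_geometry \<Gamma>)"
    if g: "g \<in> G" and u: "u \<in> elems (P_geometry \<Gamma>)" for g u
    using u by (cases rule: P_elems_cases; use g parts_image[OF g] in auto)+
  show ?thesis
  proof (rule coset_geometry_isomorphic[where act = P_map and b = b and \<Delta> = "P_geometry \<Gamma>"
        and Ks = "halving_subgroup \<Gamma> C",
      OF group_halving_group, unfolded carrier_halving_group mult_halving_group one_halving_group
      H_eq_G[OF nb] incident_P ty_P])
    show "typeset (P_geometry \<Gamma>) = {..<n}" by (simp add: P_geometry_def types)
    show "P_map (g \<cdot> h) u = P_map g (P_map h u)"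
      if gh: "g \<in> G" "h \<in> G" and u: "u \<in> elems (P_geometry \<Gamma>)" for g h u
      using u
    proof (cases rule: P_elems_cases)
      case (Part x P)
      have "(g \<cdot> h) ` P = g ` h ` P"
        using P_part_E[OF Part(2-4)] gh unfolding image_image by (intro image_cong) auto
      then show ?thesis using Part gh by simp
    qed (use gh in auto)
    show "P_map \<one>\<^bsub>Aut \<Gamma>\<^esub> u = u" if u: "u \<in> elems (P_geometry \<Gamma>)" for u
      using u
    proof (cases rule: P_elems_cases)
      case (Part x P)
      have "\<one>\<^bsub>Aut \<Gamma>\<^esub> ` P = (\<lambda>x. x) ` P"
        using P_part_E[OF Part(2-4)] by (intro image_cong) auto
      then show ?thesis using Part by simp
    qed auto
    show "P_ty \<Gamma> u \<in> {..<n}" if "u \<in> elems (P_geometry \<Gamma>)" for u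
      using that by (cases rule: P_elems_cases) (use rank up in auto)
    show "P_incident \<Gamma> u u" if "u \<in> elems (P_geometry \<Gamma>)" for u
      using that
    proof (cases rule: P_elems_cases)
      case (Part x P)
      then show ?thesis using parts_nonempty[OF Part(4)] inc_refl by auto
    qed auto
    show "P_incident \<Gamma> (P_map g u) (P_map g v)"
      if g: "g \<in> G" and u: "u \<in> elems (P_geometry \<Gamma>)" and v: "v \<in> elems (P_geometry \<Gamma>)"
        and uv: "P_incident \<Gamma> u v" for g u v
    proof (cases "P_ty \<Gamma> u \<le> P_ty \<Gamma> v")
      case True
      then show ?thesis by (rule P_act_inc[OF g u v uv])
    next
      case False
      then have "P_incident \<Gamma> (P_map g v) (P_map g u)"
        by (intro P_act_inc[OF g v u P_incident_sym[OF u v uv]]) simp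
      then show ?thesis by (rule P_incident_sym[OF actE[OF g v] actE[OF g u]])
    qed
    show "P_incident \<Gamma> (b i) (b j)" if "i \<in> {..<n}" "j \<in> {..<n}" for i j
    proof (cases "i \<le> j")
      case True
      then show ?thesis using b_inc that by simp
    next
      case False
      then have "P_incident \<Gamma> (b j) (b i)" using b_inc that by simp
      then show ?thesis using P_incident_sym bE that by simp
    qed
    show "\<exists>g\<in>G. P_map g (b (P_ty \<Gamma> u)) = u \<and> P_map g (b (P_ty \<Gamma> v)) = v"
      if "u \<in> elems (P_geometry \<Gamma>)" "v \<in> elems (P_geometry \<Gamma>)" "P_incident \<Gamma> u v" for u v
    proof (cases "P_ty \<Gamma> u \<le> P_ty \<Gamma> v")
      case True
      then show ?thesis by (rule trans[OF that])
    next
      case False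
      then have "\<exists>g\<in>G. P_map g (b (P_ty \<Gamma> v)) = v \<and> P_map g (b (P_ty \<Gamma> u)) = u"
        by (intro trans[OF that(2,1) P_incident_sym[OF that]]) simp
      then show ?thesis by blast
    qed
    show "halving_subgroup \<Gamma> C i = {g \<in> G. P_map g (b i) = b i}" if "i \<in> {..<n}" for i
    proof -
      have ti: "i = 0 \<or> i = Suc 0 \<or> i \<in> {2..<n}" using tri that by simp
      have "g \<in> H {i} \<longleftrightarrow> P_map g (b i) = b i" if g: "g \<in> G" for g
        using ti
      proof (elim disjE)
        assume "i = 0"
        then show ?thesis using H_point_stabilizer[OF g] b0 by simp
      next
        assume "i = Suc 0"
        then show ?thesis using H_opposite_point_stabilizer[OF g] b1 by simp
      next
        assume i: "i \<in> {2..<n}"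
        then have K: "{i} \<subseteq> {2..<n}" by simp
        note ci = c_upper[OF i]
        have gb: "P_map g (b i) = b i \<longleftrightarrow>
            g (c i) = c i \<and> part (g (c i)) (g p) = part (c i) p"
          using act_b2[OF g i] b2 i by simp
        \<comment> \<open>Given that \<open>c i\<close> is fixed, keeping the class of
          \<open>p\<close> means that an even walk joins \<open>p\<close> to \<open>g p\<close> in
          the residue graph of \<open>c i\<close>, and this is the parity test for
          \<open>H {i}\<close>.\<close>
        show ?thesis
        proof
          assume gH: "g \<in> H {i}"
          have gc: "g (c i) = c i" using H_fixes[OF K _ gH] by simp
          have w: "walk (graph {c i}) True p (g p)" using H_even_walk[OF K gH] by simp
          then have "g p \<in> part (c i) p"
            using walk_vertices[OF w ci(4)] unfolding part_def by simp
          then show "P_map g (b i) = b i"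
            using gb gc parts_part[OF part_in(1)[OF ci(4)]] by metis
        next
          assume "P_map g (b i) = b i"
          then have gc: "g (c i) = c i" and gp': "part (g (c i)) (g p) = part (c i) p"
            using gb by blast+
          have gp: "part (c i) (g p) = part (c i) p" using gp' unfolding gc .
          have "incident \<Gamma> (g p) (g (c i))" using g ci by simp
          then have "g p \<in> vertices (graph {c i})"
            using vertices_single[OF ci(1,2)] g gc by simp
          then have "g p \<in> part (c i) p" using part_in(2) gp by blast
          then have "walk (graph {c i}) True p (g p)" unfolding part_def by blast
          then show "g \<in> H {i}" using even_walk_in_H[OF K g] gc by simp
        qed
      qed
      then show ?thesis unfolding halving_subgroup_eq using H_closed by blast
    qed
  qed (use bE actE act_ty in auto)
qed

end

theorem theorem4p4:
  fixes \<Gamma> :: "('a, nat) incidence_structure" and C :: "'a set" and n :: nat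
  assumes "n \<ge> 3"
    and "typeset \<Gamma> = {..<n}"
    and "regular_hypertope \<Gamma>"
    and "B1 \<Gamma>" and "B2 \<Gamma>"
    and "chamber \<Gamma> C"
  shows "(\<forall>X0 X1. bipartition (truncation \<Gamma> {0, 1}) X0 X1 \<longrightarrow>
            isomorphic (coset_geometry (halving_group \<Gamma> C) {..<n} (halving_subgroup \<Gamma> C))
              (BP_geometry \<Gamma> X0 X1)) \<and>
         (\<not> bipartite (truncation \<Gamma> {0, 1}) \<longrightarrow>
            isomorphic (coset_geometry (halving_group \<Gamma> C) {..<n} (halving_subgroup \<Gamma> C))
              (P_geometry \<Gamma>))"
proof -
  interpret halving \<Gamma> C n
    by unfold_locales (use assms in auto)
  have "isomorphic (coset_geometry (halving_group \<Gamma> C) {..<n} (halving_subgroup \<Gamma> C))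
      (BP_geometry \<Gamma> X0 X1)" if X: "bipartition (graph {}) X0 X1" for X0 X1
  proof (cases "p \<in> X0")
    case True
    then show ?thesis by (rule coset_BP_isomorphic[OF X])
  next
    case False
    then have p1: "p \<in> X1" using X p_vertex[of "{}"] unfolding bipartition_def by auto
    \<comment> \<open>With \<open>p\<close> in \<open>X1\<close>, the coset geometry matches the
      geometry with the classes exchanged, and \<open>r 0\<close> exchanges them back.\<close>
    show ?thesis
      by (rule isomorphic_trans[OF coset_BP_isomorphic[OF bipartition_commute[OF X] p1]
            BP_isomorphic_swap[OF X p1]])
  qed
  then show ?thesis using coset_P_isomorphic unfolding graph_empty by blast
qed

end
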